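(* For every finite simple graph $G$ the following are equivalent. (1) $G$ is line $[B,B]$-perfect. (2) $G$ is line $[A,B]$-perfect. (3) $G$ is line $[A,-]$-perfect. (4) Neither $P_5$ nor $C_4$ is an edge-induced subgraph of $G$. (5) Every component of $G$ is a vase of flowers, a double star, or an isolated vertex.
   Context: All graphs are finite and simple; two edges are adjacent if they share an endpoint. For $X\in\{A,B\}$, $Y\in\{A,B,-\}$ and $k\in\mathbb N$, the $[X,Y]$-edge colouring game with $k$ colours on a graph $G$ is played by Alice (A) and Bob (B), who alternately colour a previously uncoloured edge with one of the $k$ colours so that adjacent edges always get distinct colours; player $X$ moves first; if $Y\in\{A,B\}$, only player $Y$ may skip any of his/her moves, and if $Y=-$ no player may skip. The game ends when no move is possible; Alice wins iff all edges are coloured. $\chi'_{[X,Y]}(G)$ is the least $k\ge0$ for which Alice has a winning strategy. $\omega(L(G))$ is the maximum number of pairwise adjacent edges of $G$. An edge-induced subgraph of $G$ is a subgraph formed by a subset of the edges together with their endpoints; "$H$ is an edge-induced subgraph of $G$" means $G$ has one isomorphic to $H$. $G$ is line $[X,Y]$-perfect if $\chi'_{[X,Y]}(H)=\omega(L(H))$ for every edge-induced subgraph $H$ of $G$. $P_n$, $C_n$: path and cycle on $n$ vertices. A vase of $n$ flowers ($n\in\mathbb N$) is a triangle $w_1w_2w_3$ plus $n$ leaves attached to $w_1$. An $(m,n)$-double star ($m,n\in\mathbb N$) is an edge $w_1w_2$ plus $m$ leaves attached to $w_1$ and $n$ leaves attached to $w_2$. *)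

theory Defs
  imports Main
begin

section \<open>Graphs\<close>

text \<open>The edges of a graph are two-element sets of vertices.\<close>

datatype 'a graph = Graph (verts: "'a set") (edges: "'a set set")

definition finite_simple_graph :: "'a graph \<Rightarrow> bool" where
  "finite_simple_graph G \<longleftrightarrow>
     finite (verts G) \<and> (\<forall>e\<in>edges G. e \<subseteq> verts G \<and> card e = 2)"

definition adjacent_edges :: "'a set \<Rightarrow> 'a set \<Rightarrow> bool" where
  "adjacent_edges e f \<longleftrightarrow> e \<noteq> f \<and> e \<inter> f \<noteq> {}"

definition graph_iso :: "'a graph \<Rightarrow> 'b graph \<Rightarrow> bool" where
  "graph_iso G H \<longleftrightarrow>
     (\<exists>\<phi>. bij_betw \<phi> (verts G) (verts H) \<and> edges H = (\<lambda>e. \<phi> ` e) ` edges G)"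

definition edge_induced :: "'a set set \<Rightarrow> 'a graph" where
  "edge_induced F = Graph (\<Union>F) F"

definition edge_induced_subgraphs :: "'a graph \<Rightarrow> 'a graph set" where
  "edge_induced_subgraphs G = edge_induced ` Pow (edges G)"

definition has_edge_induced :: "'a graph \<Rightarrow> 'b graph \<Rightarrow> bool" where
  "has_edge_induced G H \<longleftrightarrow> (\<exists>H'\<in>edge_induced_subgraphs G. graph_iso H H')"

definition vertex_induced :: "'a graph \<Rightarrow> 'a set \<Rightarrow> 'a graph" where
  "vertex_induced G U = Graph U {e \<in> edges G. e \<subseteq> U}"

definition connected_to :: "'a graph \<Rightarrow> 'a \<Rightarrow> 'a \<Rightarrow> bool" where
  "connected_to G = (\<lambda>u v. {u, v} \<in> edges G)\<^sup>*\<^sup>*"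

definition components :: "'a graph \<Rightarrow> 'a graph set" where
  "components G = (\<lambda>v. vertex_induced G {u \<in> verts G. connected_to G v u}) ` verts G"

text \<open>The clique number of the line graph.\<close>

definition line_clique_number :: "'a graph \<Rightarrow> nat" where
  "line_clique_number G =
     Max {card C | C. C \<subseteq> edges G \<and> (\<forall>e\<in>C. \<forall>f\<in>C. e \<noteq> f \<longrightarrow> adjacent_edges e f)}"


section \<open>Particular graphs\<close>

text \<open>\<open>cycle_graph n\<close> is a cycle only for \<open>n \<ge> 3\<close>.\<close>

definition path_graph :: "nat \<Rightarrow> nat graph" where
  "path_graph n = Graph {..<n} {{i, Suc i} | i. Suc i < n}"

definition cycle_graph :: "nat \<Rightarrow> nat graph" where
  "cycle_graph n = Graph {..<n} {{i, Suc i mod n} | i. i < n}"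

text \<open>
  In the next two graphs \<open>w\<^sub>1, w\<^sub>2, w\<^sub>3\<close> are \<open>0, 1, 2\<close> and the further vertices are the
  leaves. The parameters may be \<open>0\<close>: a triangle is a vase of \<open>0\<close> flowers and a star with at
  least one edge is a double star.
\<close>

definition vase :: "nat \<Rightarrow> nat graph" where
  "vase n = Graph {..<n + 3} ({{0, 1}, {0, 2}, {1, 2}} \<union> {{0, l} | l. l \<in> {3..<n + 3}})"

definition double_star :: "nat \<Rightarrow> nat \<Rightarrow> nat graph" where
  "double_star m n = Graph {..<m + n + 2}
     ({{0, 1}} \<union> {{0, l} | l. l \<in> {2..<m + 2}} \<union> {{1, l} | l. l \<in> {m + 2..<m + n + 2}})"

definition is_vase_of_flowers :: "'a graph \<Rightarrow> bool" where
  "is_vase_of_flowers G \<longleftrightarrow> (\<exists>n. graph_iso (vase n) G)"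

definition is_double_star :: "'a graph \<Rightarrow> bool" where
  "is_double_star G \<longleftrightarrow> (\<exists>m n. graph_iso (double_star m n) G)"

definition is_isolated_vertex :: "'a graph \<Rightarrow> bool" where
  "is_isolated_vertex G \<longleftrightarrow> (\<exists>v. G = Graph {v} {})"


section \<open>The edge colouring game\<close>

datatype player = Alice | Bob

fun opponent :: "player \<Rightarrow> player" where
  "opponent Alice = Bob"
| "opponent Bob = Alice"

text \<open>
  The colours are the numbers below \<open>k\<close>. A position is a partial edge colouring together with
  the player whose turn it is.
\<close>

type_synonym 'a edge_colouring = "'a set \<rightharpoonup> nat"

type_synonym 'a position = "'a edge_colouring \<times> player"

definition colouring_step :: "'a graph \<Rightarrow> nat \<Rightarrow> 'a edge_colouring \<Rightarrow> 'a edge_colouring \<Rightarrow> bool" where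
  "colouring_step G k c c' \<longleftrightarrow>
     (\<exists>e\<in>edges G. \<exists>i<k. c e = None \<and>
        (\<forall>f\<in>edges G. adjacent_edges e f \<longrightarrow> c f \<noteq> Some i) \<and> c' = c(e \<mapsto> i))"

definition game_over :: "'a graph \<Rightarrow> nat \<Rightarrow> 'a position \<Rightarrow> bool" where
  "game_over G k p \<longleftrightarrow> \<not> (\<exists>c'. colouring_step G k (fst p) c')"

text \<open>
  The parameter \<open>Y\<close> is the player who is allowed to skip, if any. Once no edge can be coloured
  the game has ended, so there is no skipping then.
\<close>

inductive legal_move :: "player option \<Rightarrow> 'a graph \<Rightarrow> nat \<Rightarrow> 'a position \<Rightarrow> 'a position \<Rightarrow> bool"
  for Y G k where
  colour: "colouring_step G k c c' \<Longrightarrow> legal_move Y G k (c, p) (c', opponent p)"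
| skip: "Y = Some p \<Longrightarrow> \<not> game_over G k (c, p) \<Longrightarrow> legal_move Y G k (c, p) (c, opponent p)"

text \<open>
  A strategy for Alice maps the history of the play, most recent position first, to the position
  reached by her move. The predicate \<open>play X Y G k \<sigma>\<close> holds of the histories that arise
  when \<open>X\<close> moves first, Alice follows \<open>\<sigma>\<close> and Bob makes arbitrary legal moves.
\<close>

type_synonym 'a strategy = "'a position list \<Rightarrow> 'a position"

inductive play :: "player \<Rightarrow> player option \<Rightarrow> 'a graph \<Rightarrow> nat \<Rightarrow> 'a strategy \<Rightarrow> 'a position list \<Rightarrow> bool"
  for X Y G k \<sigma> where
  start: "play X Y G k \<sigma> [(Map.empty, X)]"
| alice: "play X Y G k \<sigma> ((c, Alice) # ps) \<Longrightarrow> \<not> game_over G k (c, Alice) \<Longrightarrow>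
            play X Y G k \<sigma> (\<sigma> ((c, Alice) # ps) # (c, Alice) # ps)"
| bob: "play X Y G k \<sigma> ((c, Bob) # ps) \<Longrightarrow> legal_move Y G k (c, Bob) q \<Longrightarrow>
            play X Y G k \<sigma> (q # (c, Bob) # ps)"

text \<open>
  On a finite graph every play ends, because at most one of the players may skip; hence it
  suffices to inspect the positions at which the game is over.
\<close>

definition winning_strategy :: "player \<Rightarrow> player option \<Rightarrow> 'a graph \<Rightarrow> nat \<Rightarrow> 'a strategy \<Rightarrow> bool" where
  "winning_strategy X Y G k \<sigma> \<longleftrightarrow>
     (\<forall>c p ps. play X Y G k \<sigma> ((c, p) # ps) \<longrightarrow>
        (if game_over G k (c, p) then \<forall>e\<in>edges G. c e \<noteq> None
         else p = Alice \<longrightarrow> legal_move Y G k (c, p) (\<sigma> ((c, p) # ps))))"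

definition game_chromatic_index :: "player \<Rightarrow> player option \<Rightarrow> 'a graph \<Rightarrow> nat" where
  "game_chromatic_index X Y G = (LEAST k. \<exists>\<sigma>. winning_strategy X Y G k \<sigma>)"

definition line_game_perfect :: "player \<Rightarrow> player option \<Rightarrow> 'a graph \<Rightarrow> bool" where
  "line_game_perfect X Y G \<longleftrightarrow>
     (\<forall>H\<in>edge_induced_subgraphs G. game_chromatic_index X Y H = line_clique_number H)"

end

theory Submission
  imports Defs
begin

text \<open>
  On a path with five vertices or a four-cycle Alice would have to win with two colours, but
  whichever edge she colours first, Bob gives the other colour to an edge at distance two and
  so blocks the edge in between.

  Conversely, let \<open>k\<close> be the clique number of the line graph of a graph without these two
  subgraphs. An edge stays colourable for the rest of the game once the number of distinct
  colours on its neighbours plus the number of its uncoloured neighbours is less than \<open>k\<close>.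
  Initially the only other edges are the centres of double stars and the two edges of a vase
  that join its centre to the other corners of the triangle. After each of her moves Alice can
  arrange that an edge of this kind is out of danger, or has no coloured neighbour, or belongs to
  a vase in which exactly its twin edge at the centre is coloured. If Bob disturbs this in a
  double star, she colours the central edge. In a vase with no other coloured edge she repeats
  Bob's colour, on a leaf edge if he coloured the edge opposite to the centre and on that opposite
  edge if he coloured a leaf edge; if the twin was coloured already, she colours the remaining
  edge of the pair.
\<close>

section \<open>Strategies and clique numbers\<close>

text \<open>Alice plays from the current position alone: she picks, by choice, a legal move that
  keeps \<open>P\<close>. Every position of a play then satisfies \<open>P\<close>, so no play ends
  with an uncoloured edge.\<close>

lemma winning_strategy_if_invariant:
  assumes start: "P (Map.empty, X)"
    and over: "\<And>c p. P (c, p) \<Longrightarrow> game_over G k (c, p) \<Longrightarrow> \<forall>e\<in>edges G. c e \<noteq> None"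
    and alice: "\<And>c. P (c, Alice) \<Longrightarrow> \<not> game_over G k (c, Alice) \<Longrightarrow>
      \<exists>q. legal_move Y G k (c, Alice) q \<and> P q"
    and bob: "\<And>c q. P (c, Bob) \<Longrightarrow> legal_move Y G k (c, Bob) q \<Longrightarrow> P q"
  shows "\<exists>\<sigma>. winning_strategy X Y G k \<sigma>"
proof -
  define \<sigma> where "\<sigma> h = (SOME q. legal_move Y G k (hd h) q \<and> P q)" for h
  have \<sigma>: "legal_move Y G k (c, Alice) (\<sigma> ((c, Alice) # ps)) \<and> P (\<sigma> ((c, Alice) # ps))"
    if "P (c, Alice)" "\<not> game_over G k (c, Alice)" for c ps
    unfolding \<sigma>_def using someI_ex[OF alice[OF that]] by simp
  have P: "P (hd h)" if "play X Y G k \<sigma> h" for h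
    using that by induction (use start \<sigma> bob in auto)
  have "winning_strategy X Y G k \<sigma>"
    unfolding winning_strategy_def using P over \<sigma> by fastforce
  then show ?thesis by blast
qed

section \<open>Proper partial colourings along a play\<close>

definition proper :: "'a graph \<Rightarrow> nat \<Rightarrow> 'a edge_colouring \<Rightarrow> bool" where
  "proper G k c \<longleftrightarrow> (\<forall>e i. c e = Some i \<longrightarrow> i < k) \<and>
     (\<forall>e\<in>edges G. \<forall>f\<in>edges G. adjacent_edges e f \<longrightarrow> c e \<noteq> None \<longrightarrow> c e \<noteq> c f)"

lemma adjacent_edges_sym: "adjacent_edges e f \<longleftrightarrow> adjacent_edges f e"
  by (auto simp: adjacent_edges_def)

lemma adjacent_edges_irrefl [simp]: "\<not> adjacent_edges e e"
  by (simp add: adjacent_edges_def)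

lemma proper_step:
  assumes "proper G k c" "colouring_step G k c c'"
  shows "proper G k c'"
proof -
  obtain e i where "e \<in> edges G" "i < k" "c e = None"
    and free: "\<forall>f\<in>edges G. adjacent_edges e f \<longrightarrow> c f \<noteq> Some i" and c': "c' = c(e \<mapsto> i)"
    using assms(2) unfolding colouring_step_def by blast
  have "\<forall>f\<in>edges G. adjacent_edges f e \<longrightarrow> c f \<noteq> Some i"
    using free adjacent_edges_sym by blast
  then show ?thesis
    using assms(1) \<open>i < k\<close> free unfolding proper_def c' by auto
qed

lemma legal_move_cases:
  assumes "legal_move Y G k (c, p) q"
  obtains c' where "q = (c', opponent p)" "colouring_step G k c c'"
  | "q = (c, opponent p)" "Y = Some p"
  using assms by (cases rule: legal_move.cases) auto

text \<open>An arbitrary \<open>\<sigma>\<close> may answer with any position at all; winning is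
  what makes Alice's answers legal, and legal moves keep the colouring proper.\<close>

lemma winning_play_proper:
  assumes win: "winning_strategy X Y G k \<sigma>" and "play X Y G k \<sigma> h"
  shows "proper G k (fst (hd h))"
  using assms(2)
proof induction
  case start
  then show ?case by (simp add: proper_def)
next
  case (alice c ps)
  then have "legal_move Y G k (c, Alice) (\<sigma> ((c, Alice) # ps))"
    using win unfolding winning_strategy_def by fastforce
  then show ?case
    using alice.IH by (elim legal_move_cases) (auto dest: proper_step)
next
  case (bob c ps q)
  then show ?case
    by (auto elim!: legal_move_cases dest: proper_step)
qed

text \<open>Let both players only colour from here on: Alice cannot skip, and Bob is made not to.
  Each move lowers the number of uncoloured edges, and the play ends with none. So every position
  reachable against a winning strategy extends to a proper colouring of all edges; strategies are
  refuted by exhibiting a position that does not.\<close>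

lemma winning_play_completion:
  assumes win: "winning_strategy X Y G k \<sigma>" and Y: "Y \<noteq> Some Alice"
    and fin: "finite (edges G)" and "play X Y G k \<sigma> ((c, p) # ps)"
  shows "\<exists>c'. c \<subseteq>\<^sub>m c' \<and> proper G k c' \<and> (\<forall>e\<in>edges G. c' e \<noteq> None)"
  using assms(4)
proof (induction "card {e \<in> edges G. c e = None}" arbitrary: c p ps rule: less_induct)
  case less
  show ?case
  proof (cases "game_over G k (c, p)")
    case True
    then have "\<forall>e\<in>edges G. c e \<noteq> None"
      using win less.prems unfolding winning_strategy_def by fastforce
    then show ?thesis
      using winning_play_proper[OF win less.prems] by (auto intro!: exI[of _ c])
  next
    case False
    obtain c' q qs where step: "colouring_step G k c c'" and play: "play X Y G k \<sigma> ((c', q) # qs)"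
    proof (cases p)
      case Alice
      have "legal_move Y G k (c, Alice) (\<sigma> ((c, Alice) # ps))"
        using win less.prems False unfolding winning_strategy_def Alice by fastforce
      then obtain c' where "\<sigma> ((c, Alice) # ps) = (c', Bob)" "colouring_step G k c c'"
        using Y by (elim legal_move_cases) auto
      then show ?thesis
        using that play.alice[of X Y G k \<sigma> c ps] less.prems False unfolding Alice by simp
    next
      case Bob
      obtain c' where "colouring_step G k c c'"
        using False unfolding game_over_def by auto
      then show ?thesis
        using that play.bob[of X Y G k \<sigma> c ps "(c', Alice)"] legal_move.colour[of G k c c' Y Bob]
          less.prems unfolding Bob by simp
    qed
    obtain e i where e: "e \<in> edges G" "c e = None" "c' = c(e \<mapsto> i)"
      using step unfolding colouring_step_def by blast
    have "{e \<in> edges G. c' e = None} \<subset> {e \<in> edges G. c e = None}"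
      using e by (auto split: if_splits)
    then have "card {e \<in> edges G. c' e = None} < card {e \<in> edges G. c e = None}"
      using fin by (intro psubset_card_mono) auto
    then obtain c'' where "c' \<subseteq>\<^sub>m c''" "proper G k c''" "\<forall>e\<in>edges G. c'' e \<noteq> None"
      using less.hyps[OF _ play] by blast
    moreover have "c \<subseteq>\<^sub>m c'"
      using e by (auto simp: map_le_def)
    ultimately show ?thesis
      using map_le_trans by blast
  qed
qed

section \<open>Line cliques as a lower bound for the number of colours\<close>

definition line_clique :: "'a set set \<Rightarrow> 'a set set \<Rightarrow> bool" where
  "line_clique E C \<longleftrightarrow> C \<subseteq> E \<and> (\<forall>e\<in>C. \<forall>f\<in>C. e \<noteq> f \<longrightarrow> adjacent_edges e f)"

lemma
  assumes "finite (edges G)"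
  shows card_le_line_clique_number: "line_clique (edges G) C \<Longrightarrow> card C \<le> line_clique_number G"
    and line_clique_number_le: "(\<And>C. line_clique (edges G) C \<Longrightarrow> card C \<le> k) \<Longrightarrow> line_clique_number G \<le> k"
proof -
  have eq: "line_clique_number G = Max (card ` {C. line_clique (edges G) C})"
    unfolding line_clique_number_def line_clique_def image_Collect by simp
  have "finite {C. line_clique (edges G) C}"
    by (rule finite_subset[of _ "Pow (edges G)"]) (use assms in \<open>auto simp: line_clique_def\<close>)
  \<comment> \<open>The empty clique makes the set under \<open>Max\<close> nonempty.\<close>
  moreover have "line_clique (edges G) {}"
    by (simp add: line_clique_def)
  ultimately show "line_clique (edges G) C \<Longrightarrow> card C \<le> line_clique_number G"
    and "(\<And>C. line_clique (edges G) C \<Longrightarrow> card C \<le> k) \<Longrightarrow> line_clique_number G \<le> k"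
    unfolding eq by (auto intro!: Max_ge Max.boundedI)
qed

text \<open>A completed proper colouring gives distinct colours below \<open>k\<close> to the edges
  of a clique.\<close>

lemma line_clique_number_le_winning:
  assumes win: "winning_strategy X Y G k \<sigma>" and Y: "Y \<noteq> Some Alice" and fin: "finite (edges G)"
  shows "line_clique_number G \<le> k"
proof (rule line_clique_number_le[OF fin])
  fix C assume C: "line_clique (edges G) C"
  obtain c where c: "proper G k c" "\<forall>e\<in>edges G. c e \<noteq> None"
    using winning_play_completion[OF win Y fin play.start] by blast
  have "inj_on (\<lambda>e. the (c e)) C"
  proof (rule inj_onI, rule ccontr)
    fix e f assume "e \<in> C" "f \<in> C" "the (c e) = the (c f)" "e \<noteq> f"
    moreover from this C have "adjacent_edges e f" "e \<in> edges G" "f \<in> edges G"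
      unfolding line_clique_def by auto
    moreover from this c have "c e \<noteq> c f" "c e \<noteq> None" "c f \<noteq> None"
      unfolding proper_def by blast+
    ultimately show False
      by (auto dest: option.expand)
  qed
  moreover have "the (c e) < k" if "e \<in> C" for e
  proof -
    have "c e \<noteq> None"
      using c(2) C \<open>e \<in> C\<close> unfolding line_clique_def by blast
    then show ?thesis
      using c(1) unfolding proper_def by auto
  qed
  then have "(\<lambda>e. the (c e)) ` C \<subseteq> {..<k}"
    by auto
  ultimately show "card C \<le> k"
    using card_inj_on_le[of "\<lambda>e. the (c e)" C "{..<k}"] by simp
qed

lemma game_chromatic_index_eq_line_clique_number:
  assumes "winning_strategy X Y G (line_clique_number G) \<sigma>" "Y \<noteq> Some Alice" "finite (edges G)"
  shows "game_chromatic_index X Y G = line_clique_number G"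
  unfolding game_chromatic_index_def
proof (rule Least_equality)
  show "\<exists>\<sigma>. winning_strategy X Y G (line_clique_number G) \<sigma>"
    using assms(1) by blast
  show "line_clique_number G \<le> k" if "\<exists>\<sigma>. winning_strategy X Y G k \<sigma>" for k
    using that line_clique_number_le_winning[OF _ assms(2,3)] by blast
qed

section \<open>Positions in which no edge is in danger\<close>

definition line_nbrs :: "'a set set \<Rightarrow> 'a set \<Rightarrow> 'a set set" where
  "line_nbrs E e = {f \<in> E. adjacent_edges e f}"

lemma line_nbrs_iff [simp]: "f \<in> line_nbrs E e \<longleftrightarrow> f \<in> E \<and> adjacent_edges e f"
  by (simp add: line_nbrs_def)

lemma finite_line_nbrs [simp]: "finite E \<Longrightarrow> finite (line_nbrs E e)"
  by (simp add: line_nbrs_def)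

text \<open>
  The cardinality of the palette bounds the number of colours that can ever become forbidden
  for \<open>e\<close>: the colours seen by \<open>e\<close> plus its uncoloured neighbours.
\<close>

definition palette :: "'a set set \<Rightarrow> 'a edge_colouring \<Rightarrow> 'a set \<Rightarrow> ('a set + nat) set" where
  "palette E c e = (\<lambda>f. case c f of None \<Rightarrow> Inl f | Some i \<Rightarrow> Inr i) ` line_nbrs E e"

definition safe :: "'a set set \<Rightarrow> nat \<Rightarrow> 'a edge_colouring \<Rightarrow> 'a set \<Rightarrow> bool" where
  "safe E k c e \<longleftrightarrow> c e \<noteq> None \<or> card (palette E c e) < k"

lemma safe_if_few_nbrs:
  assumes "finite E" "card (line_nbrs E e) < k"
  shows "safe E k c e"
  unfolding safe_def palette_def
  using card_image_le[OF finite_line_nbrs[OF assms(1)]] assms(2) by (meson le_less_trans)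

text \<open>Two neighbours with the same colour give a single palette element, so the palette is
  smaller than the neighbourhood and \<open>k\<close> neighbours do no harm.\<close>

lemma safe_if_repeated_colour:
  assumes "finite E" "card (line_nbrs E e) \<le> k"
    and "f \<in> line_nbrs E e" "g \<in> line_nbrs E e" "f \<noteq> g" "c f = Some i" "c g = Some i"
  shows "safe E k c e"
proof -
  have "\<not> inj_on (\<lambda>f. case c f of None \<Rightarrow> Inl f | Some i \<Rightarrow> Inr i) (line_nbrs E e)"
    using assms(3-7) unfolding inj_on_def by force
  then have "card (palette E c e) < card (line_nbrs E e)"
    unfolding palette_def using assms(1)
    by (meson card_image_le eq_card_imp_inj_on finite_line_nbrs le_neq_implies_less)
  then show ?thesis
    using assms(2) unfolding safe_def by simp
qed

text \<open>Colouring \<open>g\<close> at most replaces \<open>Inl g\<close> by \<open>Inr i\<close>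
  in the palette, possibly merging it with a colour already there, so the palette never grows.
  Safety is therefore permanent.\<close>

lemma safe_step:
  assumes "finite E" "safe E k c e" "c g = None"
  shows "safe E k (c(g \<mapsto> i)) e"
proof (cases "c e = None \<and> e \<noteq> g")
  case True
  let ?r = "\<lambda>x. if x = Inl g then Inr i else x"
  have eq: "palette E (c(g \<mapsto> i)) e = ?r ` palette E c e"
    unfolding palette_def image_image
  proof (rule image_cong[OF refl])
    fix f
    show "(case (c(g \<mapsto> i)) f of None \<Rightarrow> Inl f | Some j \<Rightarrow> Inr j) =
        ?r (case c f of None \<Rightarrow> Inl f | Some j \<Rightarrow> Inr j)"
      using assms(3) by (cases "c f") auto
  qed
  have "finite (palette E c e)"
    unfolding palette_def using assms(1) by simp
  then have "card (palette E (c(g \<mapsto> i)) e) \<le> card (palette E c e)"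
    unfolding eq by (rule card_image_le)
  then show ?thesis
    using True assms(2) unfolding safe_def by simp
qed (auto simp: safe_def)

text \<open>The colours seen by \<open>e\<close> form the \<open>Inr\<close> part of the palette, so
  there are fewer than \<open>k\<close> of them.\<close>

lemma safe_colourable:
  assumes "finite E" "safe E k c e" "c e = None"
  obtains i where "i < k" "\<forall>f\<in>line_nbrs E e. c f \<noteq> Some i"
proof -
  have "finite (palette E c e)"
    unfolding palette_def using assms(1) by simp
  then have "card (Inr -` palette E c e) \<le> card (palette E c e)"
    by (intro card_inj_on_le[of Inr]) auto
  then have less: "card (Inr -` palette E c e) < card {..<k}"
    using assms(2,3) unfolding safe_def by simp
  have "finite (Inr -` palette E c e)"
    using \<open>finite (palette E c e)\<close> by (simp add: finite_vimageI)
  then have "\<not> {..<k} \<subseteq> Inr -` palette E c e"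
    using less card_mono by (meson leD)
  then obtain i where "i < k" "Inr i \<notin> palette E c e"
    by auto
  moreover have "Inr i \<in> palette E c e" if "f \<in> line_nbrs E e" "c f = Some i" for f
    unfolding palette_def by (rule image_eqI[of _ _ f]) (use that in auto)
  ultimately show ?thesis
    using that by blast
qed

text \<open>The unsafe edges of a vase: \<open>e\<close> and \<open>f\<close> meet at the centre and \<open>h\<close> is the opposite edge.\<close>

definition twins :: "'a set set \<Rightarrow> 'a set \<Rightarrow> 'a set \<Rightarrow> 'a set \<Rightarrow> bool" where
  "twins E e f h \<longleftrightarrow> f \<in> line_nbrs E e \<and> h \<in> line_nbrs E e \<and> f \<noteq> h \<and>
     insert e (line_nbrs E e) = insert f (line_nbrs E f) \<and> line_nbrs E h = {e, f} \<and>
     (\<forall>l\<in>line_nbrs E e - {f, h}. line_nbrs E l = insert e (line_nbrs E e) - {h, l})"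

text \<open>The second case is the centre of a double star, the third an edge at the centre of a vase.\<close>

definition tame :: "'a set set \<Rightarrow> nat \<Rightarrow> bool" where
  "tame E k \<longleftrightarrow> (\<forall>e\<in>E. card (line_nbrs E e) < k
     \<or> 2 \<le> k \<and> (\<forall>l\<in>line_nbrs E e. card (line_nbrs E l) < k \<and> line_nbrs E l \<subseteq> insert e (line_nbrs E e))
     \<or> 3 \<le> k \<and> card (line_nbrs E e) \<le> k \<and>
       (\<exists>f h. twins E e f h \<and> (\<forall>l\<in>line_nbrs E e - {f}. card (line_nbrs E l) < k)))"

definition fresh_edge :: "'a set set \<Rightarrow> 'a edge_colouring \<Rightarrow> 'a set \<Rightarrow> bool" where
  "fresh_edge E c e \<longleftrightarrow> (\<forall>f\<in>line_nbrs E e. c f = None)"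

definition half_done :: "'a set set \<Rightarrow> 'a edge_colouring \<Rightarrow> 'a set \<Rightarrow> bool" where
  "half_done E c e \<longleftrightarrow> (\<exists>f h. twins E e f h \<and> c f \<noteq> None \<and> (\<forall>g\<in>line_nbrs E e - {f}. c g = None))"

definition settled :: "'a set set \<Rightarrow> nat \<Rightarrow> 'a edge_colouring \<Rightarrow> 'a set \<Rightarrow> bool" where
  "settled E k c e \<longleftrightarrow> safe E k c e \<or> fresh_edge E c e \<or> half_done E c e"

text \<open>Alice restores this property with each of her moves. An edge can become unsettled only
  when Bob colours one of its neighbours.\<close>

definition stable :: "'a set set \<Rightarrow> nat \<Rightarrow> 'a edge_colouring \<Rightarrow> bool" where
  "stable E k c \<longleftrightarrow> (\<forall>e\<in>E. settled E k c e)"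

section \<open>Twins and the edges of a tame set with many neighbours\<close>

lemma not_in_line_nbrs_self: "e \<notin> line_nbrs E e"
  by simp

lemma twinsD:
  assumes "twins E e f h"
  shows "f \<in> line_nbrs E e" "h \<in> line_nbrs E e" "f \<noteq> h"
    "insert e (line_nbrs E e) = insert f (line_nbrs E f)" "line_nbrs E h = {e, f}"
    "\<And>l. l \<in> line_nbrs E e - {f, h} \<Longrightarrow> line_nbrs E l = insert e (line_nbrs E e) - {h, l}"
proof -
  note f = assms[unfolded twins_def, THEN conjunct1] and * = assms[unfolded twins_def, THEN conjunct2]
  note h = *[THEN conjunct1] and * = *[THEN conjunct2]
  note fh = *[THEN conjunct1] and * = *[THEN conjunct2]
  note N = *[THEN conjunct1] and * = *[THEN conjunct2]
  show "f \<in> line_nbrs E e" "h \<in> line_nbrs E e" "f \<noteq> h"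
    "insert e (line_nbrs E e) = insert f (line_nbrs E f)" "line_nbrs E h = {e, f}"
    by (fact f h fh N *[THEN conjunct1])+
  show "line_nbrs E l = insert e (line_nbrs E e) - {h, l}" if "l \<in> line_nbrs E e - {f, h}" for l
    using *[THEN conjunct2] that by (rule bspec)
qed

text \<open>Removing \<open>e\<close>, \<open>f\<close> and \<open>h\<close> from the common closed
  neighbourhood yields the same leaf edges for \<open>e\<close> as for \<open>f\<close>, so every
  condition passes from one twin to the other.\<close>

lemma twins_sym:
  assumes "twins E e f h"
  shows "twins E f e h"
proof -
  note tw = twinsD[OF assms]
  have ne: "e \<noteq> h" "e \<noteq> f"
    using tw(1,2) not_in_line_nbrs_self by metis+
  have e: "e \<in> line_nbrs E f"
    using tw(4) ne(2) by blast
  have h: "h \<in> line_nbrs E f"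
    using tw(2-4) by blast
  have eq: "line_nbrs E f - {e, h} = line_nbrs E e - {f, h}"
  proof -
    have "line_nbrs E f - {e, h} = insert f (line_nbrs E f) - {e, f, h}"
      using not_in_line_nbrs_self[of f E] by blast
    also have "\<dots> = line_nbrs E e - {f, h}"
      unfolding tw(4)[symmetric] using not_in_line_nbrs_self[of e E] by blast
    finally show ?thesis .
  qed
  have "line_nbrs E l = insert f (line_nbrs E f) - {h, l}"
    if "l \<in> line_nbrs E f - {e, h}" for l
    using tw(6)[of l] that unfolding eq tw(4) .
  then show ?thesis
    unfolding twins_def using e h ne(1) tw(4,5) by (simp only: insert_commute) simp
qed

lemma free_colour:
  assumes "finite F" "card F < k" "\<And>g. g \<in> line_nbrs E e - F \<Longrightarrow> c g = None"
  obtains i where "i < k" "\<forall>g\<in>line_nbrs E e. c g \<noteq> Some i"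
proof -
  \<comment> \<open>For an uncoloured member of \<open>F\<close>, \<open>the (c g)\<close> is an
    unspecified number; at worst one more colour is avoided than necessary, which the count
    covers.\<close>
  have "card ((\<lambda>g. the (c g)) ` F) < card {..<k}"
    using card_image_le[OF assms(1)] assms(2) by (metis card_lessThan le_less_trans)
  then have "\<not> {..<k} \<subseteq> (\<lambda>g. the (c g)) ` F"
    using card_mono[OF finite_imageI[OF assms(1)]] by (meson leD)
  then obtain i where "i < k" and i: "i \<notin> (\<lambda>g. the (c g)) ` F"
    by auto
  have "c g \<noteq> Some i" if "g \<in> line_nbrs E e" for g
  proof (cases "g \<in> F")
    case True
    then show ?thesis using i by (metis image_eqI option.sel)
  qed (use assms(3) that in auto)
  then show ?thesis
    using that \<open>i < k\<close> by blast
qed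

lemma colouring_stepI:
  assumes "e \<in> edges G" "c e = None" "i < k" "\<forall>f\<in>line_nbrs (edges G) e. c f \<noteq> Some i"
  shows "colouring_step G k c (c(e \<mapsto> i))"
  using assms unfolding colouring_step_def by (intro bexI[of _ e] exI[of _ i]) auto

lemma colouring_stepE:
  assumes "colouring_step G k c c'"
  obtains e i where "e \<in> edges G" "c e = None" "i < k" "\<forall>f\<in>line_nbrs (edges G) e. c f \<noteq> Some i"
    "c' = c(e \<mapsto> i)"
  using assms unfolding colouring_step_def by auto

lemma not_safe_many_nbrs: "finite E \<Longrightarrow> \<not> safe E k c e \<Longrightarrow> k \<le> card (line_nbrs E e)"
  using safe_if_few_nbrs by (meson not_le)

text \<open>Being fresh or half done depends on the neighbours of \<open>e\<close> alone, and safety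
  survives every move.\<close>

lemma settled_step:
  assumes "finite E" "settled E k c e" "c g = None" "g \<notin> line_nbrs E e"
  shows "settled E k (c(g \<mapsto> i)) e"
proof -
  have "fresh_edge E (c(g \<mapsto> i)) e" if "fresh_edge E c e"
    using that assms(4) unfolding fresh_edge_def by auto
  moreover have "half_done E (c(g \<mapsto> i)) e" if half: "half_done E c e"
  proof -
    obtain f h where "twins E e f h" "c f \<noteq> None" "\<forall>g\<in>line_nbrs E e - {f}. c g = None"
      using half unfolding half_done_def by blast
    then show ?thesis
      unfolding half_done_def using assms(3,4) by (intro exI[of _ f] exI[of _ h]) auto
  qed
  ultimately show ?thesis
    using assms safe_step unfolding settled_def by blast
qed

lemma twins_card:
  assumes "finite E" "twins E e f h"
  shows "card (line_nbrs E f) = card (line_nbrs E e)"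
proof -
  have "card (insert e (line_nbrs E e)) = card (insert f (line_nbrs E f))"
    using twinsD(4)[OF assms(2)] by simp
  then show ?thesis
    using assms(1) by simp
qed

text \<open>An edge with at least \<open>k\<close> neighbours falls under one of the last two cases
  of \<open>tame\<close>. A twin of \<open>e\<close> has as many neighbours as \<open>e\<close>,
  hence at least \<open>k\<close>: in the first case there is no such neighbour, in the second it
  can only be \<open>f\<close>. This pins down what \<open>half_done\<close> means for
  \<open>e\<close>.\<close>

lemma tame_cases [consumes 4]:
  assumes fin: "finite E" and "tame E k" and e: "e \<in> E" and "k \<le> card (line_nbrs E e)"
  obtains (solitary) "2 \<le> k" "\<And>l. l \<in> line_nbrs E e \<Longrightarrow> card (line_nbrs E l) < k"
      "\<And>l. l \<in> line_nbrs E e \<Longrightarrow> line_nbrs E l \<subseteq> insert e (line_nbrs E e)"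
      "\<And>c. \<not> half_done E c e"
  | (twin) f h where "3 \<le> k" "card (line_nbrs E e) = k" "card (line_nbrs E f) = k" "twins E e f h"
      "\<And>l. l \<in> line_nbrs E e - {f} \<Longrightarrow> card (line_nbrs E l) < k"
      "\<And>l. l \<in> line_nbrs E e \<Longrightarrow> line_nbrs E l \<subseteq> insert e (line_nbrs E e)"
      "\<And>c. half_done E c e \<Longrightarrow> c f \<noteq> None \<and> (\<forall>g\<in>line_nbrs E e - {f}. c g = None)"
proof -
  consider "2 \<le> k" "\<forall>l\<in>line_nbrs E e. card (line_nbrs E l) < k \<and> line_nbrs E l \<subseteq> insert e (line_nbrs E e)"
    | f h where "3 \<le> k" "card (line_nbrs E e) \<le> k" "twins E e f h"
      "\<forall>l\<in>line_nbrs E e - {f}. card (line_nbrs E l) < k"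
    using assms(2-4) unfolding tame_def by (meson not_le)
  then show ?thesis
  proof cases
    case 1
    have "\<not> half_done E c e" for c
    proof
      assume "half_done E c e"
      then obtain f h where tw: "twins E e f h"
        unfolding half_done_def by blast
      have "card (line_nbrs E f) < k"
        using 1(2) twinsD(1)[OF tw] by blast
      then show False
        using twins_card[OF fin tw] assms(4) by simp
    qed
    then show ?thesis
      using solitary 1 by blast
  next
    case 2
    have "c f \<noteq> None \<and> (\<forall>g\<in>line_nbrs E e - {f}. c g = None)" if half: "half_done E c e" for c
    proof -
      obtain f' h' where tw: "twins E e f' h'" "c f' \<noteq> None" "\<forall>g\<in>line_nbrs E e - {f'}. c g = None"
        using half unfolding half_done_def by blast
      moreover have "f' = f"
      proof (rule ccontr)
        assume "f' \<noteq> f"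
        then have "card (line_nbrs E f') < k"
          using 2(4) twinsD(1)[OF tw(1)] by blast
        then show False
          using twins_card[OF fin tw(1)] assms(4) by simp
      qed
      ultimately show ?thesis by blast
    qed
    \<comment> \<open>The closed neighbourhood of \<open>e\<close> is closed under adjacency. This
      is checked for the twin, the opposite edge and the leaf edges of the vase.\<close>
    moreover have "line_nbrs E l \<subseteq> insert e (line_nbrs E e)" if l: "l \<in> line_nbrs E e" for l
    proof -
      note tw = twinsD[OF 2(3)]
      consider "l = f" | "l = h" | "l \<in> line_nbrs E e - {f, h}"
        using l by blast
      then show ?thesis
      proof cases
        case 1
        then show ?thesis using tw(4) by blast
      next
        case 2
        then show ?thesis using tw(1,5) by blast
      next
        case 3
        show ?thesis unfolding tw(6)[OF 3] by blast
      qed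
    qed
    ultimately show ?thesis
      using twin[of f h] 2 twins_card[OF fin 2(3)] assms(4) by auto
  qed
qed

text \<open>If every edge is safe, any edge may be coloured. Otherwise Alice colours an unsafe edge
  \<open>e\<close>: at most one of its neighbours, its twin, is coloured, so a second colour
  suffices. The only other edge that might lose its status is the twin, and it becomes half
  done.\<close>

lemma stable_Alice_free_move:
  assumes fin: "finite (edges G)" and tame: "tame (edges G) k" and stable: "stable (edges G) k c"
    and e0: "e0 \<in> edges G" "c e0 = None"
  shows "\<exists>c'. colouring_step G k c c' \<and> stable (edges G) k c'"
proof -
  let ?E = "edges G"
  let ?N = "line_nbrs ?E"
  have settled: "settled ?E k c e" if "e \<in> ?E" for e
    using stable that unfolding stable_def settled_def by blast
  show ?thesis
  proof (cases "\<exists>e\<in>?E. \<not> safe ?E k c e")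
    case False
    have "safe ?E k c e0"
      using False e0(1) by blast
    then obtain i where "i < k" "\<forall>f\<in>?N e0. c f \<noteq> Some i"
      using safe_colourable[of ?E k c e0] fin e0(2) by blast
    then have "colouring_step G k c (c(e0 \<mapsto> i))"
      by (intro colouring_stepI e0)
    moreover have "stable ?E k (c(e0 \<mapsto> i))"
      unfolding stable_def settled_def using safe_step[OF fin] False e0(2) by blast
    ultimately show ?thesis by blast
  next
    case True
    then obtain e where e: "e \<in> ?E" and unsafe: "\<not> safe ?E k c e" by blast
    then have ce: "c e = None" unfolding safe_def by blast
    have status: "fresh_edge ?E c e \<or> half_done ?E c e"
      using settled[OF e] unsafe unfolding settled_def by blast
    have many: "k \<le> card (?N e)"
      by (rule not_safe_many_nbrs[OF fin unsafe])
    have "2 \<le> k"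
      using fin tame e many by (cases rule: tame_cases) auto
    \<comment> \<open>\<open>f\<close> is the coloured twin if \<open>e\<close> is half done, and
      arbitrary if \<open>e\<close> is fresh.\<close>
    obtain f where "\<forall>g\<in>?N e - {f}. c g = None"
      using status unfolding fresh_edge_def half_done_def by blast
    then obtain i where i: "i < k" "\<forall>f\<in>?N e. c f \<noteq> Some i"
      using free_colour[of "{f}" k ?E e c] \<open>2 \<le> k\<close> by auto
    have "settled ?E k (c(e \<mapsto> i)) e'" if e': "e' \<in> ?E" for e'
    proof (cases "safe ?E k c e' \<or> e \<notin> ?N e'")
      case True
      then show ?thesis
        using settled[OF e'] settled_step[of ?E k c e' e i] safe_step[of ?E k c e' e i] fin ce
        unfolding settled_def by blast
    next
      case False
      \<comment> \<open>An unsafe neighbour \<open>e'\<close> of \<open>e\<close> has at least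
        \<open>k\<close> neighbours, which leaves only the twin of \<open>e\<close>.\<close>
      then have e'N: "e' \<in> ?N e" and ee': "e \<in> ?N e'" and many': "k \<le> card (?N e')"
        using not_safe_many_nbrs[OF fin] e' by (auto simp: adjacent_edges_sym)
      from fin tame e many show ?thesis
      proof (cases rule: tame_cases)
        case solitary
        then show ?thesis using e'N many' by (meson leD)
      next
        case (twin f h)
        then have "e' = f"
          using e'N many' by (meson Diff_iff leD singletonD)
        have tw: "twins ?E e' e h"
          using twins_sym[OF twin(4)] \<open>e' = f\<close> by simp
        \<comment> \<open>If \<open>e'\<close> were half done, its coloured neighbour would be its
          only neighbour with at least \<open>k\<close> neighbours; but that is the uncoloured
          \<open>e\<close>.\<close>
        have "fresh_edge ?E c e'"
        proof (rule ccontr)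
          assume "\<not> fresh_edge ?E c e'"
          then have half: "half_done ?E c e'"
            using settled[OF e'] False unfolding settled_def by blast
          from fin tame e' many' show False
          proof (cases rule: tame_cases)
            case solitary
            then show False using half by blast
          next
            case (twin f'' h'')
            have "e \<in> ?N e' - {f''} \<or> e = f''" using ee' by blast
            then show False
              using twin(5,7) half many ce by (meson leD)
          qed
        qed
        then have "half_done ?E (c(e \<mapsto> i)) e'"
          unfolding half_done_def fresh_edge_def using tw
          by (intro exI[of _ e] exI[of _ h]) auto
        then show ?thesis unfolding settled_def by blast
      qed
    qed
    then have "stable ?E k (c(e \<mapsto> i))"
      unfolding stable_def settled_def by blast
    then show ?thesis
      using colouring_stepI[OF e ce i] by blast
  qed
qed

text \<open>\<open>c0\<close> is the position before Bob colours \<open>g\<close> with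
  \<open>i\<close>. An edge \<open>e\<close> that this leaves unsettled is adjacent to
  \<open>g\<close> and was fresh or half done. Alice colours \<open>e\<close> itself, unless
  \<open>e\<close> is a fresh edge with a twin; then she repeats \<open>i\<close> so that both twins
  see a repeated colour.\<close>

lemma stable_Alice_response:
  assumes fin: "finite (edges G)" and tame: "tame (edges G) k" and stable: "stable (edges G) k c0"
    and g: "c0 g = None" "i < k" and c: "c = c0(g \<mapsto> i)" and unstable: "\<not> stable (edges G) k c"
  shows "\<exists>c'. colouring_step G k c c' \<and> stable (edges G) k c'"
proof -
  let ?E = "edges G"
  let ?N = "line_nbrs ?E"
  have settled0: "settled ?E k c0 e" if "e \<in> ?E" for e
    using stable that unfolding stable_def settled_def by blast
  obtain e where e: "e \<in> ?E" and unsettled: "\<not> settled ?E k c e"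
    using unstable unfolding stable_def settled_def by blast
  have gN: "g \<in> ?N e"
    using settled_step[of ?E k c0 e g i] fin settled0[OF e] g(1) unsettled unfolding c by blast
  have unsafe0: "\<not> safe ?E k c0 e"
    using safe_step[of ?E k c0 e g i] fin g(1) unsettled unfolding settled_def c by blast
  have ce: "c e = None"
    using unsettled unfolding settled_def safe_def by blast
  have eg: "e \<noteq> g"
    using gN by auto
  have many: "k \<le> card (?N e)"
    by (rule not_safe_many_nbrs[OF fin unsafe0])
  have status: "fresh_edge ?E c0 e \<or> half_done ?E c0 e"
    using settled0[OF e] unsafe0 unfolding settled_def by blast
  \<comment> \<open>If the closed neighbourhood of \<open>e\<close> is closed under adjacency,
    neither \<open>g\<close> nor an answer \<open>x\<close> inside it is adjacent to an edge
    outside. Only the formerly unsafe edges inside need a check.\<close>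
  have c'_stable: "stable ?E k (c(x \<mapsto> j))"
    if closed: "\<And>l. l \<in> ?N e \<Longrightarrow> ?N l \<subseteq> insert e (?N e)"
      and x: "x \<in> insert e (?N e)" "c x = None"
      and near: "\<And>e'. e' \<in> insert e (?N e) \<Longrightarrow> \<not> safe ?E k c0 e' \<Longrightarrow> safe ?E k (c(x \<mapsto> j)) e'"
    for x j
  proof -
    have "settled ?E k (c(x \<mapsto> j)) e'" if e': "e' \<in> ?E" for e'
    proof (cases "safe ?E k c0 e' \<or> e' \<in> insert e (?N e)")
      case True
      then have "safe ?E k (c(x \<mapsto> j)) e'"
        using near[of e'] safe_step[of ?E k c0 e' g i] safe_step[of ?E k c e' x j] fin g(1) x(2) c
        by blast
      then show ?thesis unfolding settled_def by blast
    next
      case False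
      have "y \<notin> ?N e'" if "y \<in> insert e (?N e)" for y
      proof
        assume "y \<in> ?N e'"
        then have "e' \<in> ?N y"
          using e' by (simp add: adjacent_edges_sym)
        then show False
          using closed[of y] that False by blast
      qed
      then have "g \<notin> ?N e'" "x \<notin> ?N e'"
        using gN x(1) by blast+
      then show ?thesis
        using settled_step[of ?E k c0 e' g i] settled_step[of ?E k c e' x j] settled0[OF e']
          fin g(1) x(2) c by blast
    qed
    then show ?thesis
      unfolding stable_def settled_def by blast
  qed
  \<comment> \<open>\<open>F\<close> contains all coloured neighbours of \<open>e\<close>. Colouring
    \<open>e\<close> suffices if each of its neighbours is safe by number or already
    coloured.\<close>
  have colour_e: "\<exists>c'. colouring_step G k c c' \<and> stable ?E k c'"
    if closed: "\<And>l. l \<in> ?N e \<Longrightarrow> ?N l \<subseteq> insert e (?N e)"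
      and F: "finite F" "card F < k" "\<And>y. y \<in> ?N e - F \<Longrightarrow> c y = None"
      and near: "\<And>l. l \<in> ?N e \<Longrightarrow> card (?N l) < k \<or> c l \<noteq> None" for F
  proof -
    obtain j where j: "j < k" "\<forall>y\<in>?N e. c y \<noteq> Some j"
      using free_colour[of F k ?E e c] F by blast
    have "safe ?E k (c(e \<mapsto> j)) e'" if "e' \<in> insert e (?N e)" for e'
    proof (cases "card (?N e') < k")
      case True
      then show ?thesis
        by (rule safe_if_few_nbrs[OF fin])
    next
      case False
      then have "(c(e \<mapsto> j)) e' \<noteq> None"
        using near[of e'] that by auto
      then show ?thesis
        unfolding safe_def by blast
    qed
    then have "stable ?E k (c(e \<mapsto> j))"
      by (intro c'_stable closed ce) auto
    then show ?thesis
      using colouring_stepI[OF e ce j] by blast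
  qed
  from fin tame e many show ?thesis
  proof (cases rule: tame_cases)
    case solitary
    then have "fresh_edge ?E c0 e"
      using status by blast
    then have "c y = None" if "y \<in> ?N e - {g}" for y
      using that unfolding fresh_edge_def c by auto
    then show ?thesis
      using colour_e[of "{g}"] solitary by auto
  next
    case (twin f h)
    show ?thesis
    proof (cases "half_done ?E c0 e")
      case True
      then have f: "c0 f \<noteq> None" "\<forall>y\<in>?N e - {f}. c0 y = None"
        using twin(7) by blast+
      have "c y = None" if "y \<in> ?N e - {f, g}" for y
        using that f unfolding c by auto
      moreover have "card (?N l) < k \<or> c l \<noteq> None" if "l \<in> ?N e" for l
        using twin(5)[of l] that f(1) unfolding c by auto
      \<comment> \<open>The twin and Bob's edge may show two colours; \<open>3 \<le> k\<close>
        leaves another one for \<open>e\<close>.\<close>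
      moreover have "card {f, g} < k"
        using twin(1) card_insert_le_m1[of 2 "{g}" f] by simp
      ultimately show ?thesis
        using colour_e[of "{f, g}"] twin(6) by blast
    next
      case False
      then have fresh: "\<forall>y\<in>?N e. c0 y = None"
        using status unfolding fresh_edge_def by blast
      note tw = twinsD[OF twin(4)]
      have "g \<noteq> f"
      proof
        assume "g = f"
        then have "half_done ?E c e"
          unfolding half_done_def using twin(4) fresh c by (intro exI[of _ f] exI[of _ h]) auto
        then show False
          using unsettled unfolding settled_def by blast
      qed
      \<comment> \<open>\<open>x\<close> is to receive Bob's colour: a neighbour of \<open>e\<close>
        not adjacent to \<open>g\<close>. It is a leaf edge if \<open>g\<close> is the opposite edge
        \<open>h\<close>, and \<open>h\<close> if \<open>g\<close> is a leaf edge.\<close>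
      obtain x where x: "x \<in> ?N e" "x \<noteq> f" "x \<noteq> g" "?N x \<subseteq> insert e (?N e) - {g}"
      proof (cases "g = h")
        case True
        \<comment> \<open>A leaf edge exists because \<open>e\<close> has \<open>k\<close>
          neighbours and \<open>3 \<le> k\<close>.\<close>
        have "\<not> ?N e \<subseteq> {f, h}"
        proof
          assume "?N e \<subseteq> {f, h}"
          then have "card (?N e) \<le> card {f, h}"
            by (rule card_mono[rotated]) simp
          then show False
            using twin(1,2) tw(3) by simp
        qed
        then obtain l where l: "l \<in> ?N e - {f, h}" by blast
        show ?thesis
          by (rule that[of l]) (use l tw(6)[OF l] True in blast)+
      next
        case False
        show ?thesis
          by (rule that[of h]) (use False tw(1,2,3,5) \<open>g \<noteq> f\<close> eg in blast)+
      qed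
      have cx: "c x = None"
        using fresh x(1,3) unfolding c by simp
      \<comment> \<open>In the closed neighbourhood of \<open>e\<close> only \<open>g\<close> is
        coloured so far, and \<open>x\<close> is not adjacent to \<open>g\<close>.\<close>
      have "\<forall>y\<in>?N x. c y \<noteq> Some i"
      proof
        fix y assume "y \<in> ?N x"
        then have "y = e \<or> y \<in> ?N e" "y \<noteq> g"
          using x(4) by blast+
        then show "c y \<noteq> Some i"
          using ce fresh eg unfolding c by auto
      qed
      moreover have "x \<in> ?E"
        using x(1) by simp
      ultimately have "colouring_step G k c (c(x \<mapsto> i))"
        using cx g(2) colouring_stepI[of x G c i k] by blast
      moreover have "stable ?E k (c(x \<mapsto> i))"
      proof (rule c'_stable)
        have cols: "(c(x \<mapsto> i)) g = Some i" "(c(x \<mapsto> i)) x = Some i"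
          using x(3) unfolding c by auto
        \<comment> \<open>As the twins have the same closed neighbourhood, \<open>f\<close> sees the
          repeated colour as well as \<open>e\<close>.\<close>
        have "g \<in> ?N f" "x \<in> ?N f"
          using gN x(1,2) \<open>g \<noteq> f\<close> tw(4) by blast+
        then have "safe ?E k (c(x \<mapsto> i)) f"
          using twin(3) x(3) by (intro safe_if_repeated_colour[OF fin _ _ _ _ cols]) simp_all
        moreover have "safe ?E k (c(x \<mapsto> i)) e"
          using twin(2) x(3) by (intro safe_if_repeated_colour[OF fin _ gN x(1) _ cols]) simp_all
        ultimately show "safe ?E k (c(x \<mapsto> i)) e'"
          if "e' \<in> insert e (?N e)" "\<not> safe ?E k c0 e'" for e'
          using that twin(5)[of e'] not_safe_many_nbrs[OF fin that(2)] by fastforce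
      qed (use twin(6) x(1) cx in auto)
      ultimately show ?thesis by blast
    qed
  qed
qed

text \<open>Positions on Bob's turn are stable; those on Alice's turn are stable or one colouring
  step away from a stable one. Initially all edges are fresh, and a skip by Bob keeps the colouring,
  so one invariant serves both first players and both skipping rules.\<close>

lemma tame_winning:
  assumes fin: "finite (edges G)" and tame: "tame (edges G) k" and Y: "Y \<noteq> Some Alice"
  shows "\<exists>\<sigma>. winning_strategy X Y G k \<sigma>"
proof -
  let ?S = "stable (edges G) k"
  define P where "P = (\<lambda>(c, p). ?S c \<or> p = Alice \<and> (\<exists>c0. ?S c0 \<and> colouring_step G k c0 c))"
  \<comment> \<open>This is stated for both players because it also shows that the game is not over
    while an edge is uncoloured.\<close>
  have move: "\<exists>c'. colouring_step G k c c' \<and> ?S c'"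
    if "P (c, p)" "e \<in> edges G" "c e = None" for c p e
  proof (cases "?S c")
    case True
    then show ?thesis
      using stable_Alice_free_move[OF fin tame True that(2,3)] by blast
  next
    case False
    then obtain c0 where "?S c0" "colouring_step G k c0 c"
      using \<open>P (c, p)\<close> unfolding P_def by auto
    then show ?thesis
      using stable_Alice_response[OF fin tame] False by (metis colouring_stepE)
  qed
  show ?thesis
  proof (rule winning_strategy_if_invariant[of P])
    show "P (Map.empty, X)"
      unfolding P_def stable_def settled_def fresh_edge_def by simp
    show "\<forall>e\<in>edges G. c e \<noteq> None" if "P (c, p)" "game_over G k (c, p)" for c p
      using move[OF that(1)] that(2) unfolding game_over_def by auto
    show "\<exists>q. legal_move Y G k (c, Alice) q \<and> P q"
      if c: "P (c, Alice)" "\<not> game_over G k (c, Alice)" for c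
    proof -
      obtain e where "e \<in> edges G" "c e = None"
        using c(2) unfolding game_over_def colouring_step_def by auto
      then obtain c' where "colouring_step G k c c'" "?S c'"
        using move[OF c(1)] by blast
      then show ?thesis
        using legal_move.colour[of G k c c' Y Alice] unfolding P_def by auto
    qed
    show "P q" if "P (c, Bob)" "legal_move Y G k (c, Bob) q" for c q
      using that(2) by (rule legal_move_cases) (use that(1) in \<open>auto simp: P_def\<close>)
  qed
qed

section \<open>Graphs without paths on five vertices and four-cycles\<close>

definition joined :: "'a set set \<Rightarrow> 'a \<Rightarrow> 'a \<Rightarrow> bool" where
  "joined E u v \<longleftrightarrow> {u, v} \<in> E"

text \<open>The end \<open>e\<close> is allowed to be \<open>a\<close>, so that a path on five vertices and a four-cycle are covered at once.\<close>

definition obstructed :: "('a \<Rightarrow> 'a \<Rightarrow> bool) \<Rightarrow> bool" where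
  "obstructed R \<longleftrightarrow> (\<exists>a b c d e. R a b \<and> R b c \<and> R c d \<and> R d e \<and>
     a \<noteq> b \<and> a \<noteq> c \<and> a \<noteq> d \<and> b \<noteq> c \<and> b \<noteq> d \<and> c \<noteq> d \<and> e \<noteq> b \<and> e \<noteq> c \<and> e \<noteq> d)"

text \<open>A local form, usable inside a larger graph. For a symmetric irreflexive
  \<open>R\<close>, a common neighbour of \<open>u\<close> and \<open>v\<close> is excluded
  implicitly: as a leaf at \<open>u\<close> it would be joined to \<open>u\<close> only.\<close>

definition double_star_at :: "('a \<Rightarrow> 'a \<Rightarrow> bool) \<Rightarrow> 'a \<Rightarrow> 'a \<Rightarrow> bool" where
  "double_star_at R u v \<longleftrightarrow> R u v \<and> (\<forall>a b. R u a \<longrightarrow> a \<noteq> v \<longrightarrow> R a b \<longrightarrow> b = u) \<and>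
     (\<forall>a b. R v a \<longrightarrow> a \<noteq> u \<longrightarrow> R a b \<longrightarrow> b = v)"

definition vase_at :: "('a \<Rightarrow> 'a \<Rightarrow> bool) \<Rightarrow> 'a \<Rightarrow> 'a \<Rightarrow> 'a \<Rightarrow> bool" where
  "vase_at R x y z \<longleftrightarrow> R x y \<and> R x z \<and> R y z \<and> (\<forall>b. R y b \<longrightarrow> b = x \<or> b = z) \<and>
     (\<forall>b. R z b \<longrightarrow> b = x \<or> b = y) \<and> (\<forall>a b. R x a \<longrightarrow> a \<noteq> y \<longrightarrow> a \<noteq> z \<longrightarrow> R a b \<longrightarrow> b = x)"

locale adjacency =
  fixes R :: "'a \<Rightarrow> 'a \<Rightarrow> bool"
  assumes sym: "R u v \<Longrightarrow> R v u" and irrefl: "\<not> R u u"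
begin

lemma double_star_at_sym: "double_star_at R u v \<Longrightarrow> double_star_at R v u"
  unfolding double_star_at_def using sym by blast

lemma vase_at_sym: "vase_at R x y z \<Longrightarrow> vase_at R x z y"
  unfolding vase_at_def using sym by blast

lemma ne: "R u v \<Longrightarrow> u \<noteq> v"
  using irrefl by blast

text \<open>Consecutive vertices differ by irreflexivity, so only the other pairs are asked for;
  \<open>a\<close> and \<open>e\<close> may coincide.\<close>

lemma not_obstructed:
  assumes "\<not> obstructed R" "R a b" "R b c" "R c d" "R d e" "a \<noteq> c" "a \<noteq> d" "b \<noteq> d" "e \<noteq> b" "e \<noteq> c"
  shows False
  using assms(1) unfolding obstructed_def
  using assms(2-) ne[OF assms(2)] ne[OF assms(3)] ne[OF assms(4)] ne[OF sym[OF assms(5)]] by blast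

text \<open>A leaf \<open>a\<close> at \<open>x\<close> with a second neighbour \<open>b\<close>
  would give the forbidden walk \<open>b a x y z\<close>.\<close>

lemma vase_at_triangle:
  assumes "\<not> obstructed R" "R x y" "R x z" "R y z"
    and y: "\<And>b. R y b \<Longrightarrow> b = x \<or> b = z" and z: "\<And>b. R z b \<Longrightarrow> b = x \<or> b = y"
  shows "vase_at R x y z"
proof -
  have "b = x" if "R x a" "a \<noteq> y" "a \<noteq> z" "R a b" for a b
  proof (rule ccontr)
    assume "b \<noteq> x"
    moreover have "b \<noteq> y" "b \<noteq> z"
      using y[of a] z[of a] that sym ne by blast+
    ultimately show False
      using not_obstructed[OF assms(1), of b a x y z] that assms(2-4) sym ne by blast
  qed
  then show ?thesis
    unfolding vase_at_def using assms(2-) by blast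
qed

text \<open>Outside neighbours \<open>a\<close> of \<open>x'\<close> and \<open>b\<close> of
  \<open>y'\<close> give the forbidden walk \<open>a x' z' y' b\<close>, a four-cycle if
  \<open>a = b\<close>. So at most one corner has neighbours outside the triangle.\<close>

lemma triangle_in_vase:
  assumes "\<not> obstructed R" "R x y" "R x z" "R y z"
  shows "vase_at R x y z \<or> vase_at R y x z \<or> vase_at R z x y"
proof -
  have two: "a = y' \<or> a = z' \<or> b = x' \<or> b = z'"
    if "R x' a" "R y' b" "R x' y'" "R x' z'" "R y' z'" for x' y' z' a b
  proof (rule ccontr)
    assume "\<not> ?thesis"
    then show False
      using not_obstructed[OF assms(1), of a x' z' y' b] that sym ne by blast
  qed
  have "(\<forall>b. R y b \<longrightarrow> b = x \<or> b = z) \<and> (\<forall>b. R z b \<longrightarrow> b = x \<or> b = y) \<or>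
    (\<forall>b. R x b \<longrightarrow> b = y \<or> b = z) \<and> (\<forall>b. R z b \<longrightarrow> b = x \<or> b = y) \<or>
    (\<forall>b. R x b \<longrightarrow> b = y \<or> b = z) \<and> (\<forall>b. R y b \<longrightarrow> b = x \<or> b = z)"
    using two[of x _ y _ z] two[of x _ z _ y] two[of y _ z _ x] assms(2-4) sym by metis
  then show ?thesis
    using vase_at_triangle[OF assms(1), of x y z] vase_at_triangle[OF assms(1), of y x z]
      vase_at_triangle[OF assms(1), of z x y] assms(2-4) sym by blast
qed

text \<open>Here \<open>q\<close> is pendant at \<open>p\<close>, and \<open>p\<close> lies in no
  triangle. If no neighbour of \<open>p\<close> has a further neighbour, there is a star with
  \<open>p q\<close> as centre. Otherwise a neighbour \<open>a\<close> with a further neighbour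
  \<open>b\<close> is the second centre: the walks \<open>b' a' p a b\<close> and
  \<open>d b' a p q\<close> exclude anything beyond the leaves.\<close>

lemma double_star_at_leaf:
  assumes "\<not> obstructed R" "R p q" and q: "\<And>b. R q b \<Longrightarrow> b = p"
    and p: "\<And>a b. R p a \<Longrightarrow> R p b \<Longrightarrow> \<not> R a b"
  shows "\<exists>v. double_star_at R p v"
proof (cases "\<exists>a b. R p a \<and> a \<noteq> q \<and> R a b \<and> b \<noteq> p")
  case False
  then have "double_star_at R p q"
    unfolding double_star_at_def using assms(2) q by blast
  then show ?thesis by blast
next
  case True
  then obtain a b where ab: "R p a" "a \<noteq> q" "R a b" "b \<noteq> p" by blast
  have "b' = p" if "R p a'" "a' \<noteq> a" "R a' b'" for a' b'
  proof (rule ccontr)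
    assume "b' \<noteq> p"
    moreover have "b' \<noteq> a" "b \<noteq> a'"
      using that p ab sym by blast+
    ultimately show False
      using not_obstructed[OF assms(1), of b' a' p a b] that ab sym by blast
  qed
  moreover have "d = a" if "R a b'" "b' \<noteq> p" "R b' d" for b' d
  proof (rule ccontr)
    assume "d \<noteq> a"
    moreover have "d \<noteq> p" "q \<noteq> b'"
      using that p q ab sym by blast+
    ultimately show False
      using not_obstructed[OF assms(1), of d b' a p q] that ab assms(2) sym by blast
  qed
  ultimately have "double_star_at R p a"
    unfolding double_star_at_def using ab by blast
  then show ?thesis by blast
qed

text \<open>A triangle through \<open>p\<close> or \<open>q\<close> gives a vase. Without one,
  \<open>p q\<close> is the centre of a double star if both ends have further neighbours; otherwise
  one end is pendant and the other end is a centre.\<close>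

lemma vase_or_double_star_at:
  assumes "\<not> obstructed R" "R p q"
  shows "(\<exists>u v. double_star_at R u v \<and> (R u p \<or> R v p)) \<or> (\<exists>x y z. vase_at R x y z \<and> (p = x \<or> R x p))"
proof (cases "\<exists>r s t. R r s \<and> R r t \<and> R s t \<and> (r = p \<or> r = q)")
  case True
  then obtain r s t where t: "R r s" "R r t" "R s t" "r = p \<or> r = q" by blast
  have on: "p = x \<or> R x p" if v: "vase_at R x y z" and "r = x \<or> r = y \<or> r = z" for x y z
    using v that(2) t(4) assms(2) sym unfolding vase_at_def by metis
  show ?thesis
    using triangle_in_vase[OF assms(1) t(1-3)] on[of r s t] on[of s r t] on[of t r s] by blast
next
  case False
  then have tri: "\<not> R a b" if "R r a" "R r b" "r = p \<or> r = q" for r a b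
    using that by blast
  show ?thesis
  proof (cases "(\<exists>a. R p a \<and> a \<noteq> q) \<and> (\<exists>b. R q b \<and> b \<noteq> p)")
    case True
    \<comment> \<open>The walk \<open>b' a r s b\<close> excludes a further edge at a leaf
      \<open>a\<close> of the end \<open>r\<close>; here \<open>r\<close>, \<open>s\<close> stand
      for \<open>p\<close>, \<open>q\<close> in either order.\<close>
    have "b' = r" if "R r s" "R r a" "a \<noteq> s" "R a b'" "R s b" "b \<noteq> r" "r = p \<or> r = q"
      for r s a b b'
    proof (rule ccontr)
      assume "b' \<noteq> r"
      moreover have "b' \<noteq> s" "b \<noteq> a"
        using tri[of r a s] that sym by blast+
      ultimately show False
        using not_obstructed[OF assms(1), of b' a r s b] that sym by blast
    qed
    then have "double_star_at R p q"
      unfolding double_star_at_def using True assms(2) sym by metis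
    then show ?thesis
      using sym[OF assms(2)] by blast
  next
    case False
    then consider "\<And>b. R q b \<Longrightarrow> b = p" | "\<And>a. R p a \<Longrightarrow> a = q" by blast
    then show ?thesis
    proof cases
      case 1
      then obtain v where "double_star_at R p v"
        using double_star_at_leaf[OF assms] tri[of p] by blast
      then show ?thesis
        using sym unfolding double_star_at_def by blast
    next
      case 2
      then obtain v where "double_star_at R q v"
        using double_star_at_leaf[OF assms(1) sym[OF assms(2)]] tri[of q] by blast
      then show ?thesis
        using sym[OF assms(2)] by blast
    qed
  qed
qed

text \<open>The middle vertex \<open>c\<close> has two neighbours, so it is a centre. One of
  \<open>b\<close> and \<open>d\<close> is then a leaf, yet both have a neighbour other than
  \<open>c\<close>.\<close>

lemma double_star_at_no_walk:
  assumes "double_star_at R u v" "R u c \<or> R v c"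
    and "R a b" "R b c" "R c d" "R d e" "a \<noteq> c" "b \<noteq> d" "e \<noteq> c"
  shows False
proof -
  have *: "R u c \<Longrightarrow> c = v \<or> (\<forall>x. R c x \<longrightarrow> x = u)" "R v c \<Longrightarrow> c = u \<or> (\<forall>x. R c x \<longrightarrow> x = v)"
    using assms(1) unfolding double_star_at_def by blast+
  have "c = u \<or> c = v"
    using * assms(2,4,5,8) sym by metis
  moreover have False if "double_star_at R c w" for w
  proof -
    have "b \<noteq> w \<or> d \<noteq> w" using assms(8) by blast
    then show False
      using that assms(3-7,9) sym unfolding double_star_at_def by metis
  qed
  ultimately show False
    using assms(1) double_star_at_sym by blast
qed

text \<open>Leaves have one neighbour, so \<open>c\<close> is a corner of the triangle, and then so
  are \<open>b\<close> and \<open>d\<close>. Whichever of \<open>b\<close> and \<open>d\<close> is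
  not the centre has only the other two corners as neighbours, which forces \<open>a = d\<close> or
  \<open>e = b\<close>.\<close>

lemma vase_at_no_walk:
  assumes "vase_at R x y z" "c = x \<or> R x c"
    and "R a b" "R b c" "R c d" "R d e" "a \<noteq> c" "b \<noteq> d" "e \<noteq> c" "a \<noteq> d" "e \<noteq> b"
  shows False
proof -
  have *: "c = x \<or> c = y \<or> c = z"
    using assms(1,2,4,5,8) sym unfolding vase_at_def by metis
  have y: False if "vase_at R x c z" for z
  proof -
    have "b = x \<and> d = z \<or> b = z \<and> d = x"
      using that assms(4,5,8) sym unfolding vase_at_def by metis
    then show False
      using that assms(3,6-) sym unfolding vase_at_def by metis
  qed
  have x: False if "vase_at R c y z"
  proof -
    have "(b = y \<or> b = z) \<and> (d = y \<or> d = z)"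
      using that assms(3-7,9) sym unfolding vase_at_def by metis
    then show False
      using that assms(3,6-) sym unfolding vase_at_def by metis
  qed
  show False
    using * x y[of z] y[of y] assms(1) vase_at_sym by blast
qed

end

lemma finite_simple_graphD:
  assumes "finite_simple_graph G"
  shows "finite (edges G)" "\<And>e. e \<in> edges G \<Longrightarrow> card e = 2"
proof -
  have "edges G \<subseteq> Pow (verts G)" "finite (verts G)"
    using assms unfolding finite_simple_graph_def by auto
  then show "finite (edges G)"
    using finite_subset by blast
qed (use assms in \<open>auto simp: finite_simple_graph_def\<close>)

lemma adjacency_joined:
  assumes "\<And>e. e \<in> E \<Longrightarrow> card e = 2"
  shows "adjacency (joined E)"
proof
  show "joined E u v \<Longrightarrow> joined E v u" for u v
    unfolding joined_def by (simp add: insert_commute)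
  show "\<not> joined E u u" for u
    unfolding joined_def using assms[of "{u, u}"] by auto
qed

section \<open>From the local shape of a graph to tameness\<close>

definition edges_at :: "'a set set \<Rightarrow> 'a \<Rightarrow> 'a set set" where
  "edges_at E u = {f \<in> E. u \<in> f}"

lemma edges_at_iff [simp]: "f \<in> edges_at E u \<longleftrightarrow> f \<in> E \<and> u \<in> f"
  by (simp add: edges_at_def)

lemma line_nbrs_edge: "line_nbrs E {u, v} = (edges_at E u \<union> edges_at E v) - {{u, v}}"
  by (auto simp: adjacent_edges_def)

context
  fixes E :: "'a set set" and k :: nat
  assumes fin: "finite E" and card2: "\<And>e. e \<in> E \<Longrightarrow> card e = 2"
    and clique_card: "\<And>C. line_clique E C \<Longrightarrow> card C \<le> k"
begin

interpretation adjacency "joined E"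
  by (rule adjacency_joined[OF card2])

lemma edge_at:
  assumes "f \<in> E" "u \<in> f"
  obtains a where "f = {u, a}" "joined E u a"
proof -
  obtain a b where "f = {a, b}"
    using card2[OF assms(1)] by (auto simp: card_2_iff)
  then have "f = {u, a} \<or> f = {u, b}"
    using assms(2) by auto
  then show ?thesis
    using that assms(1) unfolding joined_def by blast
qed

lemma edges_at_eq: "edges_at E u = {{u, a} | a. joined E u a}"
proof (intro set_eqI iffI)
  fix f assume "f \<in> edges_at E u"
  then have "f \<in> E" "u \<in> f" by simp_all
  then show "f \<in> {{u, a} | a. joined E u a}"
    by (rule edge_at) blast
qed (auto simp: joined_def)

lemma edges_at_clique: "line_clique E (edges_at E u)"
  unfolding line_clique_def by (auto simp: adjacent_edges_def)

text \<open>The clique contains \<open>e\<close> besides all its neighbours, and \<open>k\<close>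
  bounds the size of every clique.\<close>

lemma card_line_nbrs_less:
  assumes "line_clique E C" "e \<in> C" "line_nbrs E e \<subseteq> C"
  shows "card (line_nbrs E e) < k"
proof -
  have "finite C"
    using assms(1) fin finite_subset unfolding line_clique_def by blast
  then have "card (line_nbrs E e) \<le> card (C - {e})"
    using assms(3) by (intro card_mono) auto
  also have "\<dots> < card C"
    using assms(2) \<open>finite C\<close> by (intro card_Diff1_less)
  finally show ?thesis
    using clique_card[OF assms(1)] by simp
qed

lemma pendant_edge:
  assumes "joined E u a" and a: "\<And>b. joined E a b \<Longrightarrow> b = u"
  shows "line_nbrs E {u, a} = edges_at E u - {{u, a}}" and "card (line_nbrs E {u, a}) < k"
proof -
  have "edges_at E a \<subseteq> edges_at E u"
    unfolding edges_at_eq using assms(1) sym a by (auto simp: insert_commute)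
  then show eq: "line_nbrs E {u, a} = edges_at E u - {{u, a}}"
    unfolding line_nbrs_edge by blast
  show "card (line_nbrs E {u, a}) < k"
    by (rule card_line_nbrs_less[OF edges_at_clique[of u]])
      (use assms(1) eq in \<open>auto simp: joined_def\<close>)
qed

lemma double_star_centre_tame:
  assumes uv: "double_star_at (joined E) u v" and many: "\<not> card (line_nbrs E {u, v}) < k"
  shows "2 \<le> k \<and> (\<forall>l\<in>line_nbrs E {u, v}.
    card (line_nbrs E l) < k \<and> line_nbrs E l \<subseteq> insert {u, v} (line_nbrs E {u, v}))"
proof -
  have e: "{u, v} \<in> E"
    using uv unfolding double_star_at_def joined_def by blast
  have *: "card (line_nbrs E l) < k \<and> line_nbrs E l \<subseteq> insert {u', v'} (line_nbrs E {u', v'})"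
    if uv: "double_star_at (joined E) u' v'" and l: "l \<in> E" "u' \<in> l" "l \<noteq> {u', v'}" for u' v' l
  proof -
    obtain a where a: "l = {u', a}" "joined E u' a"
      using edge_at[OF l(1,2)] by blast
    then have "\<And>b. joined E a b \<Longrightarrow> b = u'"
      using uv l(3) unfolding double_star_at_def by blast
    from pendant_edge[OF a(2) this] show ?thesis
      unfolding a(1) line_nbrs_edge[of E u' v'] by blast
  qed
  have "card (line_nbrs E l) < k \<and> line_nbrs E l \<subseteq> insert {u, v} (line_nbrs E {u, v})"
    if "l \<in> line_nbrs E {u, v}" for l
  proof -
    have "l \<in> E" "l \<noteq> {u, v}" "u \<in> l \<or> v \<in> l"
      using that unfolding line_nbrs_edge by auto
    then show ?thesis
      using *[OF uv, of l] *[OF double_star_at_sym[OF uv], of l] by (auto simp: insert_commute)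
  qed
  \<comment> \<open>A single edge is a clique, so \<open>k\<close> is positive and the centre has
    some neighbour \<open>l\<close>; these two edges form a larger clique.\<close>
  moreover have "2 \<le> k"
  proof -
    have "card {{u, v}} \<le> k"
      by (rule clique_card) (use e in \<open>auto simp: line_clique_def\<close>)
    then have "line_nbrs E {u, v} \<noteq> {}"
      using many by auto
    then obtain l where l: "l \<in> line_nbrs E {u, v}" by blast
    have "card {{u, v}, l} \<le> k"
      by (rule clique_card) (use e l in \<open>auto simp: line_clique_def adjacent_edges_sym\<close>)
    moreover have "l \<noteq> {u, v}" using l by auto
    ultimately show ?thesis by simp
  qed
  ultimately show ?thesis by blast
qed

lemma vase_corners:
  assumes v: "vase_at (joined E) x y z"
  shows "edges_at E y = {{x, y}, {y, z}}" "edges_at E z = {{x, z}, {y, z}}"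
proof -
  have "joined E y a \<longleftrightarrow> a = x \<or> a = z" "joined E z a \<longleftrightarrow> a = x \<or> a = y" for a
    using v sym unfolding vase_at_def by blast+
  then show "edges_at E y = {{x, y}, {y, z}}" "edges_at E z = {{x, z}, {y, z}}"
    unfolding edges_at_eq by (auto simp: insert_commute)
qed

text \<open>The opposite edge and its two neighbours form the triangle, a clique of three
  edges.\<close>

lemma vase_opposite_edge:
  assumes v: "vase_at (joined E) x y z"
  shows "line_nbrs E {y, z} = {{x, y}, {x, z}}" and "card (line_nbrs E {y, z}) < k" and "3 \<le> k"
proof -
  have R: "joined E x y" "joined E x z" "joined E y z"
    using v unfolding vase_at_def by blast+
  then have ne: "x \<noteq> y" "x \<noteq> z" "y \<noteq> z"
    using ne by blast+
  note at = vase_corners[OF v]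
  show eq: "line_nbrs E {y, z} = {{x, y}, {x, z}}"
    unfolding line_nbrs_edge at using ne by (auto simp: doubleton_eq_iff)
  have C: "line_clique E {{x, y}, {x, z}, {y, z}}"
    using R unfolding line_clique_def adjacent_edges_def joined_def by auto
  show "card (line_nbrs E {y, z}) < k"
    by (rule card_line_nbrs_less[OF C]) (auto simp: eq)
  have "card {{x, y}, {x, z}, {y, z}} = 3"
    using ne by (simp add: doubleton_eq_iff)
  then show "3 \<le> k"
    using clique_card[OF C] by simp
qed

text \<open>The neighbours of \<open>{x, y}\<close> are the other edges at \<open>x\<close> and the
  opposite edge, as many as there are edges at \<open>x\<close>. The closed neighbourhoods of
  \<open>{x, y}\<close> and \<open>{x, z}\<close> both consist of the edges at \<open>x\<close> and
  \<open>{y, z}\<close>; the leaf edges are pendant.\<close>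

lemma vase_centre_tame:
  assumes v: "vase_at (joined E) x y z"
  shows "card (line_nbrs E {x, y}) \<le> k \<and> twins E {x, y} {x, z} {y, z} \<and>
    (\<forall>l\<in>line_nbrs E {x, y} - {{x, z}}. card (line_nbrs E l) < k)"
proof -
  have R: "joined E x y" "joined E x z" "joined E y z"
    using v unfolding vase_at_def by blast+
  then have ne: "x \<noteq> y" "x \<noteq> z" "y \<noteq> z"
    using ne by blast+
  have E: "{x, y} \<in> E" "{x, z} \<in> E" "{y, z} \<in> E"
    using R unfolding joined_def by auto
  note opp = vase_opposite_edge[OF v]
  note at = vase_corners[OF v]
  have N: "line_nbrs E {x, y} = insert {y, z} (edges_at E x - {{x, y}})"
    "line_nbrs E {x, z} = insert {y, z} (edges_at E x - {{x, z}})"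
    unfolding line_nbrs_edge at using ne by (auto simp: doubleton_eq_iff)
  have closed: "insert {x, y} (line_nbrs E {x, y}) = insert {y, z} (edges_at E x)"
    "insert {x, z} (line_nbrs E {x, z}) = insert {y, z} (edges_at E x)"
    unfolding N using E by auto
  have "{y, z} \<notin> edges_at E x" "finite (edges_at E x)"
    using ne fin by (auto simp: edges_at_def)
  then have "card (line_nbrs E {x, y}) = card (edges_at E x)"
    unfolding N using E(1) card_Suc_Diff1[of "edges_at E x" "{x, y}"] by (simp del: card_Diff_insert)
  then have card: "card (line_nbrs E {x, y}) \<le> k"
    using clique_card[OF edges_at_clique] by simp
  have leaf: "line_nbrs E l = edges_at E x - {l} \<and> card (line_nbrs E l) < k"
    if "l \<in> line_nbrs E {x, y} - {{x, z}, {y, z}}" for l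
  proof -
    have l: "l \<in> E" "x \<in> l" "l \<noteq> {x, y}" "l \<noteq> {x, z}"
      using that unfolding N by auto
    obtain a where a: "l = {x, a}" "joined E x a"
      using edge_at[OF l(1,2)] by blast
    then have "\<And>b. joined E a b \<Longrightarrow> b = x"
      using v l(3,4) unfolding vase_at_def by blast
    from pendant_edge[OF a(2) this] show ?thesis
      unfolding a(1) by blast
  qed
  have "twins E {x, y} {x, z} {y, z}"
    unfolding twins_def
  proof (intro conjI ballI)
    show "{x, z} \<in> line_nbrs E {x, y}" "{y, z} \<in> line_nbrs E {x, y}" "{x, z} \<noteq> {y, z}"
      unfolding N using E ne by (auto simp: doubleton_eq_iff)
    show "insert {x, y} (line_nbrs E {x, y}) = insert {x, z} (line_nbrs E {x, z})"
      unfolding closed ..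
    show "line_nbrs E {y, z} = {{x, y}, {x, z}}"
      by (rule opp(1))
    show "line_nbrs E l = insert {x, y} (line_nbrs E {x, y}) - {{y, z}, l}"
      if "l \<in> line_nbrs E {x, y} - {{x, z}, {y, z}}" for l
      unfolding leaf[OF that, THEN conjunct1] closed
      using \<open>{y, z} \<notin> edges_at E x\<close> by blast
  qed
  moreover have "card (line_nbrs E l) < k" if "l \<in> line_nbrs E {x, y} - {{x, z}}" for l
    using leaf[of l] opp(2) that by blast
  ultimately show ?thesis
    using card by blast
qed

text \<open>Every edge lies in a local double star or vase. Pendant edges and the edge opposite to
  the centre of a vase have fewer than \<open>k\<close> neighbours; what remains are the two other
  kinds of edge allowed by \<open>tame\<close>.\<close>

lemma tame_if_not_obstructed:
  assumes "\<not> obstructed (joined E)"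
  shows "tame E k"
  unfolding tame_def
proof
  fix e assume e: "e \<in> E"
  let ?tame = "\<lambda>e. card (line_nbrs E e) < k
     \<or> 2 \<le> k \<and> (\<forall>l\<in>line_nbrs E e. card (line_nbrs E l) < k \<and> line_nbrs E l \<subseteq> insert e (line_nbrs E e))
     \<or> 3 \<le> k \<and> card (line_nbrs E e) \<le> k \<and>
       (\<exists>f h. twins E e f h \<and> (\<forall>l\<in>line_nbrs E e - {f}. card (line_nbrs E l) < k))"
  obtain p q where pq: "e = {p, q}"
    using card2[OF e] by (auto simp: card_2_iff)
  then have R: "joined E p q"
    using e unfolding joined_def by simp
  have qp: "e = {q, p}"
    unfolding pq by (rule insert_commute)
  \<comment> \<open>The edge is written with its first end at a given centre; \<open>pq\<close> and
    \<open>qp\<close> supply both orientations.\<close>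
  have star: "?tame e" if uv: "double_star_at (joined E) u v" and ab: "joined E a b" "a = u" and "e = {a, b}" for u v a b
  proof (cases "b = v")
    case True
    then show ?thesis
      using double_star_centre_tame[OF uv] that by blast
  next
    case False
    then show ?thesis
      using pendant_edge(2)[OF ab(1)] that unfolding double_star_at_def by blast
  qed
  have vase: "?tame e" if v: "vase_at (joined E) x y z" and ab: "joined E a b" "a = x" and "e = {a, b}" for x y z a b
  proof -
    consider "b = y" | "b = z" | "b \<noteq> y" "b \<noteq> z" by blast
    then show ?thesis
    proof cases
      case 1
      then show ?thesis
        using vase_centre_tame[OF v] vase_opposite_edge(3)[OF v] that by blast
    next
      case 2
      note v' = vase_at_sym[OF v]
      show ?thesis
        using 2 vase_centre_tame[OF v'] vase_opposite_edge(3)[OF v'] that by blast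
    next
      case 3
      then show ?thesis
        using pendant_edge(2)[OF ab(1)] that unfolding vase_at_def by blast
    qed
  qed
  have near_star: "?tame e" if uv: "double_star_at (joined E) u v" and "joined E u p" for u v
  proof -
    have "p = v \<or> q = u"
      using R that unfolding double_star_at_def by blast
    then show ?thesis
      using star[OF double_star_at_sym[OF uv] R _ pq] star[OF uv sym[OF R] _ qp] by (rule disjE)
  qed
  show "?tame e"
    using vase_or_double_star_at[OF assms R]
  proof (elim disjE exE conjE)
    show ?thesis if "double_star_at (joined E) u v" "joined E u p" for u v
      by (rule near_star[OF that])
    show ?thesis if "double_star_at (joined E) u v" "joined E v p" for u v
      by (rule near_star[OF double_star_at_sym[OF that(1)] that(2)])
    show ?thesis if "vase_at (joined E) x y z" "p = x" for x y z
      by (rule vase[OF that(1) R that(2) pq])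
    show ?thesis if v: "vase_at (joined E) x y z" and "joined E x p" for x y z
    proof -
      have "e = {y, z} \<or> p = x \<or> q = x"
        using that R sym pq qp unfolding vase_at_def by metis
      then show ?thesis
        using vase[OF v R _ pq] vase[OF v sym[OF R] _ qp] vase_opposite_edge(2)[OF v]
        by (elim disjE) simp_all
    qed
  qed
qed

end

section \<open>Line game-perfection\<close>

text \<open>Edge-induced subgraphs inherit the absence of forbidden walks. On each of them Alice
  wins with as many colours as its clique number, and fewer never suffice.\<close>

lemma line_game_perfect_if_not_obstructed:
  assumes G: "finite_simple_graph G" and "\<not> obstructed (joined (edges G))" and Y: "Y \<noteq> Some Alice"
  shows "line_game_perfect X Y G"
  unfolding line_game_perfect_def edge_induced_subgraphs_def
proof clarify
  fix F assume F: "F \<subseteq> edges G"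
  let ?H = "edge_induced F"
  have H: "edges ?H = F"
    by (simp add: edge_induced_def)
  have fin: "finite (edges ?H)"
    unfolding H using F finite_simple_graphD(1)[OF G] finite_subset by blast
  have "\<not> obstructed (joined (edges ?H))"
    using assms(2) F unfolding obstructed_def joined_def H by blast
  then have "tame (edges ?H) (line_clique_number ?H)"
    using finite_simple_graphD(2)[OF G] F
    by (intro tame_if_not_obstructed[OF fin _ card_le_line_clique_number[OF fin]]) (auto simp: H)
  then obtain \<sigma> where "winning_strategy X Y ?H (line_clique_number ?H) \<sigma>"
    using tame_winning[OF fin _ Y] by blast
  then show "game_chromatic_index X Y ?H = line_clique_number ?H"
    by (rule game_chromatic_index_eq_line_clique_number[OF _ Y fin])
qed

text \<open>With more colours than edges no edge has too many neighbours. This ensures that the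
  \<open>LEAST\<close> in the game chromatic index is attained.\<close>

lemma winning_strategy_exists:
  assumes fin: "finite (edges G)" and Y: "Y \<noteq> Some Alice"
  shows "\<exists>\<sigma>. winning_strategy X Y G (Suc (card (edges G))) \<sigma>"
proof (rule tame_winning[OF fin _ Y])
  have "card (line_nbrs (edges G) e) \<le> card (edges G)" for e
    using fin by (intro card_mono) (auto simp: line_nbrs_def)
  then show "tame (edges G) (Suc (card (edges G)))"
    unfolding tame_def by (simp add: less_Suc_eq_le)
qed

text \<open>Bob answers Alice's first edge \<open>e\<close> by giving the other colour to \<open>e'\<close>, which blocks \<open>m\<close>.\<close>

lemma Bob_wins_two_colours:
  assumes fin: "finite (edges G)" and "edges G \<noteq> {}"
    and block: "\<And>e. e \<in> edges G \<Longrightarrow>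
      \<exists>e'\<in>edges G. \<exists>m\<in>edges G. e' \<noteq> e \<and> adjacent_edges m e \<and> adjacent_edges m e'"
    and Y: "Y \<noteq> Some Alice" and XY: "X = Alice \<or> Y = Some Bob"
  shows "\<not> winning_strategy X Y G 2 \<sigma>"
proof
  assume win: "winning_strategy X Y G 2 \<sigma>"
  obtain e0 where "e0 \<in> edges G"
    using assms(2) by blast
  then have "colouring_step G 2 Map.empty [e0 \<mapsto> 0]"
    unfolding colouring_step_def by (intro bexI[of _ e0] exI[of _ 0]) auto
  then have not_over: "\<not> game_over G 2 (Map.empty, p)" for p
    unfolding game_over_def by auto
  \<comment> \<open>Alice is brought to make the first colouring move: she begins, or Bob
    skips.\<close>
  obtain ps where ps: "play X Y G 2 \<sigma> ((Map.empty, Alice) # ps)"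
  proof (cases X)
    case Alice
    then show ?thesis
      using that play.start[of X Y G 2 \<sigma>] by simp
  next
    case Bob
    then have "legal_move Y G 2 (Map.empty, Bob) (Map.empty, opponent Bob)"
      using XY not_over by (intro legal_move.skip) auto
    then have "play X Y G 2 \<sigma> [(Map.empty, Alice), (Map.empty, Bob)]"
      using play.bob[of X Y G 2 \<sigma> Map.empty "[]"] play.start[of X Y G 2 \<sigma>] Bob by simp
    then show ?thesis
      by (rule that)
  qed
  have "legal_move Y G 2 (Map.empty, Alice) (\<sigma> ((Map.empty, Alice) # ps))"
    using win ps not_over unfolding winning_strategy_def by fastforce
  then obtain c where c: "\<sigma> ((Map.empty, Alice) # ps) = (c, Bob)" "colouring_step G 2 Map.empty c"
    using Y by (elim legal_move_cases) auto
  then have play: "play X Y G 2 \<sigma> ((c, Bob) # (Map.empty, Alice) # ps)"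
    using play.alice[OF ps not_over] by simp
  obtain e a where e: "e \<in> edges G" "a < 2" "c = [e \<mapsto> a]"
    using c(2) unfolding colouring_step_def by auto
  obtain e' m where m: "e' \<in> edges G" "m \<in> edges G" "e' \<noteq> e" "adjacent_edges m e" "adjacent_edges m e'"
    using block[OF e(1)] by blast
  define b :: nat where "b = 1 - a"
  have "b < 2" "a \<noteq> b"
    using e(2) unfolding b_def by arith+
  then have "colouring_step G 2 c (c(e' \<mapsto> b))"
    using m(1,3) unfolding colouring_step_def e(3) by (intro bexI[of _ e'] exI[of _ b]) auto
  then have "legal_move Y G 2 (c, Bob) (c(e' \<mapsto> b), Alice)"
    using legal_move.colour[of G 2 c _ Y Bob] by simp
  \<comment> \<open>A completion would have to give \<open>m\<close> a third colour besides
    \<open>a\<close> and \<open>b\<close>.\<close>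
  from winning_play_completion[OF win Y fin play.bob[OF play this]]
  obtain c' where c': "c(e' \<mapsto> b) \<subseteq>\<^sub>m c'" "proper G 2 c'" "\<forall>e\<in>edges G. c' e \<noteq> None"
    by blast
  have "c' e = Some a" "c' e' = Some b"
    using c'(1) m(3) unfolding map_le_def e(3) by (auto dest!: bspec split: if_splits)
  moreover obtain i where i: "c' m = Some i"
    using c'(3) m(2) by blast
  moreover have "c' m \<noteq> c' e" "c' m \<noteq> c' e'"
    using c'(2) m e(1) i unfolding proper_def by blast+
  moreover have "i < 2"
    using c'(2) i unfolding proper_def by blast
  ultimately show False
    using \<open>a < 2\<close> \<open>b < 2\<close> \<open>a \<noteq> b\<close> by auto
qed

text \<open>For four consecutive edges of a path or cycle the excluded pairs are those at distance
  two. \<open>?D\<close> picks from each pair the one edge that \<open>C\<close> may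
  contain.\<close>

lemma card_le_2_if_excluded_pairs:
  assumes "C \<subseteq> {p, q, r, s}" "p \<notin> C \<or> r \<notin> C" "q \<notin> C \<or> s \<notin> C"
  shows "card C \<le> 2"
proof -
  let ?D = "{if p \<in> C then p else r, if q \<in> C then q else s}"
  have "card C \<le> card ?D"
    by (rule card_mono) (use assms in auto)
  also have "\<dots> \<le> 2"
    by (simp add: card_insert_if)
  finally show ?thesis .
qed

lemma obstructed_not_line_game_perfect:
  assumes G: "finite_simple_graph G" and "obstructed (joined (edges G))"
    and Y: "Y \<noteq> Some Alice" and XY: "X = Alice \<or> Y = Some Bob"
  shows "\<not> line_game_perfect X Y G"
proof
  assume perfect: "line_game_perfect X Y G"
  obtain a b c d e where E: "{a, b} \<in> edges G" "{b, c} \<in> edges G" "{c, d} \<in> edges G" "{d, e} \<in> edges G"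
    and ne: "a \<noteq> b" "a \<noteq> c" "a \<noteq> d" "b \<noteq> c" "b \<noteq> d" "c \<noteq> d" "e \<noteq> b" "e \<noteq> c" "e \<noteq> d"
    using assms(2) unfolding obstructed_def joined_def by blast
  define F where "F = {{a, b}, {b, c}, {c, d}, {d, e}}"
  let ?H = "edge_induced F"
  have H: "edges ?H = F"
    by (simp add: edge_induced_def)
  have HF: "edges ?H = {{a, b}, {b, c}, {c, d}, {d, e}}"
    by (rule trans[OF H F_def])
  have fin: "finite (edges ?H)"
    unfolding HF by simp
  \<comment> \<open>Nothing is claimed about \<open>{a, b}\<close> and \<open>{d, e}\<close>, which
    are adjacent exactly if \<open>e = a\<close>.\<close>
  have adj: "adjacent_edges {a, b} {b, c}" "adjacent_edges {b, c} {c, d}" "adjacent_edges {c, d} {d, e}"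
    "\<not> adjacent_edges {a, b} {c, d}" "\<not> adjacent_edges {b, c} {d, e}"
    "{a, b} \<noteq> {c, d}" "{b, c} \<noteq> {d, e}" "{a, b} \<noteq> {b, c}"
    using ne unfolding adjacent_edges_def by (auto simp: doubleton_eq_iff)
  have "line_clique_number ?H = 2"
  proof (rule antisym)
    show "line_clique_number ?H \<le> 2"
    proof (rule line_clique_number_le[OF fin])
      fix C assume C: "line_clique (edges ?H) C"
      have sub: "C \<subseteq> {{a, b}, {b, c}, {c, d}, {d, e}}"
        using C unfolding line_clique_def HF by simp
      have "x \<notin> C \<or> y \<notin> C" if "\<not> adjacent_edges x y" "x \<noteq> y" for x y
        using C that unfolding line_clique_def by blast
      from card_le_2_if_excluded_pairs[OF sub this[OF adj(4,6)] this[OF adj(5,7)]]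
      show "card C \<le> 2" .
    qed
    have "line_clique (edges ?H) {{a, b}, {b, c}}"
      using adj(1) adj(1)[unfolded adjacent_edges_sym[of "{a, b}"]]
      unfolding line_clique_def HF by auto
    then have "card {{a, b}, {b, c}} \<le> line_clique_number ?H"
      by (rule card_le_line_clique_number[OF fin])
    then show "2 \<le> line_clique_number ?H"
      using adj(8) by simp
  qed
  moreover have "?H \<in> edge_induced_subgraphs G"
    unfolding edge_induced_subgraphs_def F_def using E by blast
  ultimately have "game_chromatic_index X Y ?H = 2"
    using perfect unfolding line_game_perfect_def by auto
  \<comment> \<open>Since the least number is attained, a game chromatic index of two yields a
    strategy with exactly two colours.\<close>
  moreover have "\<exists>\<sigma>. winning_strategy X Y ?H (game_chromatic_index X Y ?H) \<sigma>"
    unfolding game_chromatic_index_def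
    using winning_strategy_exists[OF fin Y] by (rule LeastI)
  ultimately obtain \<sigma> where "winning_strategy X Y ?H 2 \<sigma>"
    by auto
  moreover have "\<not> winning_strategy X Y ?H 2 \<sigma>"
  proof (rule Bob_wins_two_colours[OF fin _ _ Y XY])
    show "edges ?H \<noteq> {}"
      unfolding HF by simp
    \<comment> \<open>Bob answers within the pairs \<open>{a, b}\<close>, \<open>{c, d}\<close> and
      \<open>{b, c}\<close>, \<open>{d, e}\<close>; the blocked edge is \<open>{b, c}\<close> or
      \<open>{c, d}\<close>, respectively.\<close>
    fix f assume "f \<in> edges ?H"
    then consider "f = {a, b}" | "f = {b, c}" | "f = {c, d}" | "f = {d, e}"
      unfolding HF by blast
    moreover have "{a, b} \<in> F" "{b, c} \<in> F" "{c, d} \<in> F" "{d, e} \<in> F"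
      unfolding F_def by auto
    ultimately show "\<exists>e'\<in>edges ?H. \<exists>m\<in>edges ?H. e' \<noteq> f \<and> adjacent_edges m f \<and> adjacent_edges m e'"
      unfolding H by cases (use adj adjacent_edges_sym in metis)+
  qed
  ultimately show False by blast
qed

text \<open>The assumptions cover the three games in question: Alice never skips, and she begins or
  can be made to colour first by a skip of Bob.\<close>

lemma line_game_perfect_iff:
  assumes "finite_simple_graph G" "Y \<noteq> Some Alice" "X = Alice \<or> Y = Some Bob"
  shows "line_game_perfect X Y G \<longleftrightarrow> \<not> obstructed (joined (edges G))"
  using line_game_perfect_if_not_obstructed obstructed_not_line_game_perfect assms by blast

section \<open>Forbidden subgraphs and components\<close>

lemma obstructedI:
  assumes "{a, b} \<in> E" "{b, c} \<in> E" "{c, d} \<in> E" "{d, e} \<in> E"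
    and "distinct [a, b, c, d]" "e \<notin> {b, c, d}"
  shows "obstructed (joined E)"
  unfolding obstructed_def joined_def using assms
  by (intro exI[of _ a] exI[of _ b] exI[of _ c] exI[of _ d] exI[of _ e]) auto

lemma obstructedE:
  assumes "obstructed (joined E)"
  obtains a b c d e where "{a, b} \<in> E" "{b, c} \<in> E" "{c, d} \<in> E" "{d, e} \<in> E"
    and "distinct [a, b, c, d]" "e \<notin> {b, c, d}"
  using assms unfolding obstructed_def joined_def by force

lemma obstructed_image:
  assumes "obstructed (joined E)" "inj_on \<phi> (\<Union>E)"
  shows "obstructed (joined ((`) \<phi> ` E))"
proof -
  obtain a b c d e where E: "{a, b} \<in> E" "{b, c} \<in> E" "{c, d} \<in> E" "{d, e} \<in> E"
    and ne: "distinct [a, b, c, d]" "e \<notin> {b, c, d}"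
    using assms(1) by (rule obstructedE)
  have img: "{\<phi> x, \<phi> y} \<in> (`) \<phi> ` E" if "{x, y} \<in> E" for x y
    using imageI[OF that, of "(`) \<phi>"] by simp
  have "a \<in> \<Union>E" "b \<in> \<Union>E" "c \<in> \<Union>E" "d \<in> \<Union>E" "e \<in> \<Union>E"
    using E by auto
  then have "distinct [\<phi> a, \<phi> b, \<phi> c, \<phi> d]" "\<phi> e \<notin> {\<phi> b, \<phi> c, \<phi> d}"
    using ne inj_on_eq_iff[OF assms(2)] by simp_all
  then show ?thesis
    by (rule obstructedI[OF img[OF E(1)] img[OF E(2)] img[OF E(3)] img[OF E(4)]])
qed

lemma obstructed_mono:
  assumes "obstructed (joined E)" "E \<subseteq> F"
  shows "obstructed (joined F)"
  using assms unfolding obstructed_def joined_def by blast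

text \<open>As the edges consist of vertices in \<open>verts G\<close>, the inverse bijection takes
  their images back, so forbidden walks transfer in both directions.\<close>

lemma obstructed_graph_iso:
  assumes "graph_iso G H" "\<Union>(edges G) \<subseteq> verts G"
  shows "obstructed (joined (edges G)) \<longleftrightarrow> obstructed (joined (edges H))"
proof -
  obtain \<phi> where \<phi>: "bij_betw \<phi> (verts G) (verts H)" "edges H = (\<lambda>e. \<phi> ` e) ` edges G"
    using assms(1) unfolding graph_iso_def by blast
  define \<psi> where "\<psi> = inv_into (verts G) \<phi>"
  have inj: "inj_on \<phi> (verts G)"
    using \<phi>(1) by (rule bij_betw_imp_inj_on)
  have "\<psi> ` \<phi> ` e = e" if "e \<in> edges G" for e
    using that assms(2) inj unfolding \<psi>_def image_image
    by (subst image_cong[OF refl, where g = "\<lambda>x. x"]) (auto simp: inv_into_f_f)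
  then have "(`) \<psi> ` edges H = edges G"
    unfolding \<phi>(2) image_image by simp
  moreover have "inj_on \<psi> (\<Union>(edges H))"
    unfolding \<psi>_def using assms(2) by (intro inj_on_inv_into) (auto simp: \<phi>(2))
  moreover have "inj_on \<phi> (\<Union>(edges G))"
    using inj assms(2) by (rule inj_on_subset)
  ultimately show ?thesis
    using obstructed_image[of "edges G" \<phi>] obstructed_image[of "edges H" \<psi>] \<phi>(2) by auto
qed

lemma has_edge_induced_obstructed:
  assumes "has_edge_induced G H" "\<Union>(edges H) \<subseteq> verts H" "obstructed (joined (edges H))"
  shows "obstructed (joined (edges G))"
proof -
  obtain F where "F \<subseteq> edges G" "graph_iso H (edge_induced F)"
    using assms(1) unfolding has_edge_induced_def edge_induced_subgraphs_def by blast
  then show ?thesis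
    using obstructed_graph_iso[of H "edge_induced F"] obstructed_mono assms(2,3)
    unfolding edge_induced_def by auto
qed

lemma edges_path_graph_5: "edges (path_graph 5) = {{0, 1}, {1, 2}, {2, 3}, {3, 4}}"
proof -
  have "edges (path_graph 5) = (\<lambda>i. {i, Suc i}) ` {..<4}"
    unfolding path_graph_def by auto
  moreover have "{..<4::nat} = {0, 1, 2, 3}"
    by auto
  ultimately show ?thesis by (simp flip: numeral_2_eq_2)
qed

lemma edges_cycle_graph_4: "edges (cycle_graph 4) = {{0, 1}, {1, 2}, {2, 3}, {3, 0}}"
proof -
  have "edges (cycle_graph 4) = (\<lambda>i. {i, Suc i mod 4}) ` {..<4}"
    unfolding cycle_graph_def by auto
  moreover have "{..<4::nat} = {0, 1, 2, 3}"
    by auto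
  ultimately show ?thesis by (simp flip: numeral_2_eq_2)
qed

lemma has_edge_inducedI:
  assumes "F \<subseteq> edges G" "bij_betw \<phi> (verts H) (\<Union>F)" "F = (\<lambda>e. \<phi> ` e) ` edges H"
  shows "has_edge_induced G H"
proof -
  have "graph_iso H (edge_induced F)"
    unfolding graph_iso_def edge_induced_def using assms(2,3) by auto
  then show ?thesis
    unfolding has_edge_induced_def edge_induced_subgraphs_def using assms(1) by blast
qed

text \<open>A forbidden walk is a four-cycle if \<open>e = a\<close> and a path on five vertices
  otherwise; indexing the list of its vertices gives the embedding.\<close>

lemma obstructed_iff_has_edge_induced:
  assumes "finite_simple_graph G"
  shows "obstructed (joined (edges G)) \<longleftrightarrow>
    has_edge_induced G (path_graph 5) \<or> has_edge_induced G (cycle_graph 4)"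
proof
  assume "obstructed (joined (edges G))"
  then obtain a b c d e where E: "{a, b} \<in> edges G" "{b, c} \<in> edges G" "{c, d} \<in> edges G" "{d, e} \<in> edges G"
    and ne: "distinct [a, b, c, d]" "e \<notin> {b, c, d}"
    by (rule obstructedE)
  show "has_edge_induced G (path_graph 5) \<or> has_edge_induced G (cycle_graph 4)"
  proof (cases "e = a")
    case True
    have "has_edge_induced G (cycle_graph 4)"
    proof (rule has_edge_inducedI[where \<phi> = "(!) [a, b, c, d]" and F = "{{a, b}, {b, c}, {c, d}, {d, a}}"])
      have "bij_betw ((!) [a, b, c, d]) {..<4} (set [a, b, c, d])"
        using ne(1) by (intro bij_betw_nth) auto
      then show "bij_betw ((!) [a, b, c, d]) (verts (cycle_graph 4)) (\<Union>{{a, b}, {b, c}, {c, d}, {d, a}})"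
        unfolding cycle_graph_def by (simp add: insert_commute)
    qed (use E True in \<open>auto simp: edges_cycle_graph_4\<close>)
    then show ?thesis ..
  next
    case False
    have "has_edge_induced G (path_graph 5)"
    proof (rule has_edge_inducedI[where \<phi> = "(!) [a, b, c, d, e]" and F = "{{a, b}, {b, c}, {c, d}, {d, e}}"])
      have "bij_betw ((!) [a, b, c, d, e]) {..<5} (set [a, b, c, d, e])"
        using ne False by (intro bij_betw_nth) auto
      then show "bij_betw ((!) [a, b, c, d, e]) (verts (path_graph 5)) (\<Union>{{a, b}, {b, c}, {c, d}, {d, e}})"
        unfolding path_graph_def by (simp add: insert_commute)
    qed (use E in \<open>auto simp: edges_path_graph_5\<close>)
    then show ?thesis ..
  qed
next
  have "obstructed (joined (edges (path_graph 5)))"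
    unfolding edges_path_graph_5 by (rule obstructedI[of 0 1 _ 2 3 4]) auto
  moreover have "obstructed (joined (edges (cycle_graph 4)))"
    unfolding edges_cycle_graph_4 by (rule obstructedI[of 0 1 _ 2 3 0]) auto
  moreover have "\<Union>(edges (path_graph 5)) \<subseteq> verts (path_graph 5)"
    "\<Union>(edges (cycle_graph 4)) \<subseteq> verts (cycle_graph 4)"
    unfolding edges_path_graph_5 edges_cycle_graph_4 by (auto simp: path_graph_def cycle_graph_def)
  moreover assume "has_edge_induced G (path_graph 5) \<or> has_edge_induced G (cycle_graph 4)"
  ultimately show "obstructed (joined (edges G))"
    using has_edge_induced_obstructed by blast
qed

section \<open>Vases and double stars contain no forbidden walk\<close>

lemma edges_vase: "edges (vase n) = {{0, 1}, {0, 2}, {1, 2}} \<union> (\<lambda>l. {0, l}) ` {3..<n + 3}"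
  unfolding vase_def by auto

lemma edges_double_star: "edges (double_star m n) =
    {{0, 1}} \<union> (\<lambda>l. {0, l}) ` {2..<m + 2} \<union> (\<lambda>l. {1, l}) ` {m + 2..<m + n + 2}"
  unfolding double_star_def by auto

lemma joined_vase: "joined (edges (vase n)) a b \<longleftrightarrow>
    a = 0 \<and> b \<noteq> 0 \<and> b < n + 3 \<or> b = 0 \<and> a \<noteq> 0 \<and> a < n + 3 \<or> a = 1 \<and> b = 2 \<or> a = 2 \<and> b = 1"
  unfolding joined_def edges_vase by (auto simp: doubleton_eq_iff image_iff)

lemma joined_double_star: "joined (edges (double_star m n)) a b \<longleftrightarrow>
    a = 0 \<and> b \<noteq> 0 \<and> b < m + 2 \<or> b = 0 \<and> a \<noteq> 0 \<and> a < m + 2 \<or>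
    a = 1 \<and> m + 2 \<le> b \<and> b < m + n + 2 \<or> b = 1 \<and> m + 2 \<le> a \<and> a < m + n + 2"
  unfolding joined_def edges_double_star by (auto simp: doubleton_eq_iff image_iff)

lemma vase_not_obstructed: "\<not> obstructed (joined (edges (vase n)))"
proof
  let ?R = "joined (edges (vase n))"
  assume "obstructed ?R"
  then obtain a b c d e where walk: "?R a b" "?R b c" "?R c d" "?R d e"
    and diff: "a \<noteq> c" "b \<noteq> d" "e \<noteq> c" "a \<noteq> d" "e \<noteq> b"
    unfolding obstructed_def by metis
  interpret adjacency ?R
    by (rule adjacency_joined) (auto simp: edges_vase)
  have vase: "vase_at ?R 0 1 2"
    unfolding vase_at_def joined_vase by auto
  have c: "c = 0 \<or> ?R 0 c"
    using walk(2) unfolding joined_vase by auto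
  show False
    by (rule vase_at_no_walk[OF vase c walk diff])
qed

lemma double_star_not_obstructed: "\<not> obstructed (joined (edges (double_star m n)))"
proof
  let ?R = "joined (edges (double_star m n))"
  assume "obstructed ?R"
  then obtain a b c d e where walk: "?R a b" "?R b c" "?R c d" "?R d e"
    and diff: "a \<noteq> c" "b \<noteq> d" "e \<noteq> c"
    unfolding obstructed_def by metis
  interpret adjacency ?R
    by (rule adjacency_joined) (auto simp: edges_double_star)
  have star: "double_star_at ?R 0 1"
    unfolding double_star_at_def joined_double_star by auto
  have c: "?R 0 c \<or> ?R 1 c"
    using walk(2) unfolding joined_double_star by auto
  show False
    by (rule double_star_at_no_walk[OF star c walk diff])
qed

text \<open>All vertices of the walk are reachable from its middle vertex \<open>c\<close>, so the
  walk lies in the component of \<open>c\<close>.\<close>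

lemma obstructed_component:
  assumes G: "finite_simple_graph G" and "obstructed (joined (edges G))"
  shows "\<exists>K\<in>components G. obstructed (joined (edges K))"
proof -
  obtain a b c d e where E: "{a, b} \<in> edges G" "{b, c} \<in> edges G" "{c, d} \<in> edges G" "{d, e} \<in> edges G"
    and diff: "distinct [a, b, c, d]" "e \<notin> {b, c, d}"
    using assms(2) by (rule obstructedE)
  let ?U = "{u \<in> verts G. connected_to G c u}"
  have verts: "{a, b, c, d, e} \<subseteq> verts G"
    using E G unfolding finite_simple_graph_def by blast
  have step: "connected_to G c y" if "connected_to G c x" "{x, y} \<in> edges G" for x y
    using that unfolding connected_to_def by (rule rtranclp.rtrancl_into_rtrancl)
  have c: "connected_to G c c"
    unfolding connected_to_def by simp
  have b: "connected_to G c b" and d: "connected_to G c d"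
    using step[OF c] E by (simp_all add: insert_commute)
  have "connected_to G c a" "connected_to G c e"
    using step[OF b] step[OF d] E by (simp_all add: insert_commute)
  then have "{a, b, c, d, e} \<subseteq> ?U"
    using b c d verts by simp
  then have "obstructed (joined (edges (vertex_induced G ?U)))"
    unfolding vertex_induced_def by (intro obstructedI[OF _ _ _ _ diff]) (use E in simp_all)
  moreover have "vertex_induced G ?U \<in> components G"
    unfolding components_def using verts by auto
  ultimately show ?thesis by blast
qed

lemma component_vertices:
  assumes "S \<subseteq> verts G" "v \<in> S" and "\<And>w w'. w \<in> S \<Longrightarrow> joined (edges G) w w' \<Longrightarrow> w' \<in> S"
    and "\<And>w. w \<in> S \<Longrightarrow> (joined (edges G))\<^sup>*\<^sup>* v w"
  shows "{u \<in> verts G. connected_to G v u} = S"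
proof -
  have eq: "connected_to G = (joined (edges G))\<^sup>*\<^sup>*"
    unfolding connected_to_def joined_def ..
  have "u \<in> S" if "(joined (edges G))\<^sup>*\<^sup>* v u" for u
    using that by (induction rule: rtranclp_induct) (use assms(2,3) in auto)
  then show ?thesis
    unfolding eq using assms(1,4) by auto
qed

lemma image_pairs: "\<phi> ` I = J \<Longrightarrow> (\<lambda>e. \<phi> ` e) ` (\<lambda>l. {i, l}) ` I = (\<lambda>a. {\<phi> i, a}) ` J"
  by (auto simp: image_image)

context
  fixes G :: "'a graph"
  assumes G: "finite_simple_graph G"
begin

interpretation adjacency "joined (edges G)"
  by (rule adjacency_joined[OF finite_simple_graphD(2)[OF G]])

lemma joined_verts: "joined (edges G) u v \<Longrightarrow> u \<in> verts G \<and> v \<in> verts G"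
  using G unfolding joined_def finite_simple_graph_def by blast

lemma finite_joined: "finite {w. joined (edges G) u w}"
proof (rule finite_subset)
  show "{w. joined (edges G) u w} \<subseteq> verts G"
    using joined_verts by blast
  show "finite (verts G)"
    using G unfolding finite_simple_graph_def by blast
qed

lemma edges_vertex_induced:
  "edges (vertex_induced G S) = {{p, q} | p q. p \<in> S \<and> q \<in> S \<and> joined (edges G) p q}"
proof (intro equalityI subsetI)
  fix e assume "e \<in> edges (vertex_induced G S)"
  then have e: "e \<in> edges G" "e \<subseteq> S"
    unfolding vertex_induced_def by simp_all
  obtain p q where "e = {p, q}"
    using finite_simple_graphD(2)[OF G e(1)] by (auto simp: card_2_iff)
  then show "e \<in> {{p, q} | p q. p \<in> S \<and> q \<in> S \<and> joined (edges G) p q}"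
    using e unfolding joined_def by blast
qed (auto simp: vertex_induced_def joined_def)

text \<open>The set consists of the two centres, which are neighbours of each other, and of two sets
  of leaves. Enumerating the leaves along the labels of the standard double star gives the
  isomorphism; the leaf conditions exclude further edges.\<close>

lemma double_star_at_is_double_star:
  assumes uv: "double_star_at (joined (edges G)) u v"
  shows "is_double_star (vertex_induced G {w. joined (edges G) u w \<or> joined (edges G) v w})"
    (is "is_double_star (vertex_induced G ?S)")
proof -
  let ?R = "joined (edges G)"
  define A where "A = {w. ?R u w} - {v}"
  define B where "B = {w. ?R v w} - {u}"
  define m where "m = card A"
  define n where "n = card B"
  have R: "?R u v" "?R v u"
    using uv sym unfolding double_star_at_def by blast+
  have leaf: "w \<in> A \<Longrightarrow> ?R w b \<Longrightarrow> b = u" "w \<in> B \<Longrightarrow> ?R w b \<Longrightarrow> b = v" for w b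
    using uv unfolding double_star_at_def A_def B_def by blast+
  have S: "?S = {u} \<union> {v} \<union> A \<union> B"
    unfolding A_def B_def using R by blast
  \<comment> \<open>A common leaf would have both \<open>u\<close> and \<open>v\<close> as its only
    neighbour.\<close>
  have disj: "u \<noteq> v" "u \<notin> A" "v \<notin> A" "u \<notin> B" "v \<notin> B" "A \<inter> B = {}"
    using ne[OF R(1)] irrefl leaf sym unfolding A_def B_def by blast+
  have "finite A" "finite B"
    unfolding A_def B_def using finite_joined by auto
  obtain f where f: "bij_betw f {2..<m + 2} A"
    using finite_same_card_bij[OF _ \<open>finite A\<close>, of "{2..<m + 2}"] unfolding m_def by auto
  obtain g where g: "bij_betw g {m + 2..<m + n + 2} B"
    using finite_same_card_bij[OF _ \<open>finite B\<close>, of "{m + 2..<m + n + 2}"] unfolding n_def by auto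
  define \<phi> where "\<phi> i = (if i = 0 then u else if i = 1 then v else if i < m + 2 then f i else g i)" for i
  have \<phi>01: "\<phi> 0 = u" "\<phi> 1 = v"
    unfolding \<phi>_def by auto
  have \<phi>A: "bij_betw \<phi> {2..<m + 2} A"
    using f by (rule bij_betw_cong[THEN iffD1, rotated]) (simp add: \<phi>_def)
  have \<phi>B: "bij_betw \<phi> {m + 2..<m + n + 2} B"
    using g by (rule bij_betw_cong[THEN iffD1, rotated]) (simp add: \<phi>_def)
  have "bij_betw \<phi> ({0} \<union> {1} \<union> {2..<m + 2} \<union> {m + 2..<m + n + 2}) ({u} \<union> {v} \<union> A \<union> B)"
    using disj by (intro bij_betw_combine \<phi>A \<phi>B) (auto simp: \<phi>01[unfolded One_nat_def] bij_betw_def)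
  moreover have "{0} \<union> {1} \<union> {2..<m + 2} \<union> {m + 2..<m + n + 2} = {..<m + n + 2}"
    by auto
  ultimately have bij: "bij_betw \<phi> {..<m + n + 2} ?S"
    unfolding S by simp
  have "edges (vertex_induced G ?S) = {{u, v}} \<union> (\<lambda>a. {u, a}) ` A \<union> (\<lambda>b. {v, b}) ` B"
  proof (intro equalityI subsetI)
    fix e assume "e \<in> edges (vertex_induced G ?S)"
    then obtain p q where e: "e = {p, q}" and pq: "p \<in> ?S" "?R p q"
      unfolding edges_vertex_induced by blast
    from pq(1) consider "p = u" | "p = v" | "p \<in> A" | "p \<in> B"
      unfolding S by blast
    then show "e \<in> {{u, v}} \<union> (\<lambda>a. {u, a}) ` A \<union> (\<lambda>b. {v, b}) ` B"
    proof cases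
      case 1
      then show ?thesis using pq(2) unfolding e A_def by blast
    next
      case 2
      then show ?thesis using pq(2) unfolding e B_def by (cases "q = u") auto
    next
      case 3
      then show ?thesis using leaf(1)[OF 3 pq(2)] unfolding e by blast
    next
      case 4
      then show ?thesis using leaf(2)[OF 4 pq(2)] unfolding e by blast
    qed
  next
    fix e assume "e \<in> {{u, v}} \<union> (\<lambda>a. {u, a}) ` A \<union> (\<lambda>b. {v, b}) ` B"
    then show "e \<in> edges (vertex_induced G ?S)"
      unfolding edges_vertex_induced A_def B_def using R by blast
  qed
  also have "\<dots> = (\<lambda>e. \<phi> ` e) ` edges (double_star m n)"
    unfolding edges_double_star image_Un image_pairs[OF bij_betw_imp_surj_on[OF \<phi>A]]
      image_pairs[OF bij_betw_imp_surj_on[OF \<phi>B]] \<phi>01 image_insert image_empty ..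
  finally have "graph_iso (double_star m n) (vertex_induced G ?S)"
    unfolding graph_iso_def using bij by (auto simp: double_star_def vertex_induced_def)
  then show ?thesis
    unfolding is_double_star_def by blast
qed

text \<open>As for double stars: the labels 0, 1, 2 go to \<open>x\<close>, \<open>y\<close>,
  \<open>z\<close>, and the others enumerate the leaves.\<close>

lemma vase_at_is_vase:
  assumes v: "vase_at (joined (edges G)) x y z"
  shows "is_vase_of_flowers (vertex_induced G {w. w = x \<or> joined (edges G) x w})"
    (is "is_vase_of_flowers (vertex_induced G ?S)")
proof -
  let ?R = "joined (edges G)"
  define A where "A = {w. ?R x w} - {y, z}"
  define n where "n = card A"
  have R: "?R x y" "?R x z" "?R y z"
    using v unfolding vase_at_def by blast+
  have leaf: "w \<in> A \<Longrightarrow> ?R w b \<Longrightarrow> b = x" "?R y b \<Longrightarrow> b = x \<or> b = z" "?R z b \<Longrightarrow> b = x \<or> b = y" for w b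
    using v unfolding vase_at_def A_def by blast+
  have S: "?S = {x} \<union> {y} \<union> {z} \<union> A"
    unfolding A_def using R by blast
  have disj: "x \<noteq> y" "x \<noteq> z" "y \<noteq> z" "x \<notin> A" "y \<notin> A" "z \<notin> A"
    using ne R irrefl unfolding A_def by blast+
  have "finite A"
    unfolding A_def using finite_joined by auto
  obtain f where f: "bij_betw f {3..<n + 3} A"
    using finite_same_card_bij[OF _ \<open>finite A\<close>, of "{3..<n + 3}"] unfolding n_def by auto
  define \<phi> where "\<phi> i = (if i = 0 then x else if i = 1 then y else if i = 2 then z else f i)" for i :: nat
  have \<phi>012: "\<phi> 0 = x" "\<phi> 1 = y" "\<phi> 2 = z"
    unfolding \<phi>_def by auto
  have \<phi>A: "bij_betw \<phi> {3..<n + 3} A"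
    using f by (rule bij_betw_cong[THEN iffD1, rotated]) (simp add: \<phi>_def)
  have "bij_betw \<phi> ({0} \<union> {1} \<union> {2} \<union> {3..<n + 3}) ({x} \<union> {y} \<union> {z} \<union> A)"
    using disj by (intro bij_betw_combine \<phi>A) (auto simp: \<phi>012[unfolded One_nat_def] bij_betw_def)
  moreover have "{0} \<union> {1} \<union> {2} \<union> {3..<n + 3} = {..<n + 3}"
    by auto
  ultimately have bij: "bij_betw \<phi> {..<n + 3} ?S"
    unfolding S by simp
  have "edges (vertex_induced G ?S) = {{x, y}, {x, z}, {y, z}} \<union> (\<lambda>a. {x, a}) ` A"
  proof (intro equalityI subsetI)
    fix e assume "e \<in> edges (vertex_induced G ?S)"
    then obtain p q where e: "e = {p, q}" and pq: "p \<in> ?S" "?R p q"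
      unfolding edges_vertex_induced by blast
    from pq(1) consider "p = x" | "p = y" | "p = z" | "p \<in> A"
      unfolding S by blast
    then show "e \<in> {{x, y}, {x, z}, {y, z}} \<union> (\<lambda>a. {x, a}) ` A"
    proof cases
      case 1
      then show ?thesis using pq(2) unfolding e A_def by blast
    next
      case 2
      then show ?thesis using leaf(2)[of q] pq(2) unfolding e by auto
    next
      case 3
      then show ?thesis using leaf(3)[of q] pq(2) unfolding e by auto
    next
      case 4
      then show ?thesis using leaf(1)[OF 4 pq(2)] unfolding e by blast
    qed
  next
    fix e assume "e \<in> {{x, y}, {x, z}, {y, z}} \<union> (\<lambda>a. {x, a}) ` A"
    then show "e \<in> edges (vertex_induced G ?S)"
      unfolding edges_vertex_induced A_def using R by blast
  qed
  also have "\<dots> = (\<lambda>e. \<phi> ` e) ` edges (vase n)"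
    unfolding edges_vase image_Un image_pairs[OF bij_betw_imp_surj_on[OF \<phi>A]]
      \<phi>012 image_insert image_empty ..
  finally have "graph_iso (vase n) (vertex_induced G ?S)"
    unfolding graph_iso_def using bij by (auto simp: vase_def vertex_induced_def)
  then show ?thesis
    unfolding is_vase_of_flowers_def by blast
qed

text \<open>A vertex with a neighbour lies in a local vase or double star. The vertices of this are
  closed under adjacency and reachable from it, hence they form its component.\<close>

lemma component_shape:
  assumes no: "\<not> obstructed (joined (edges G))" and K: "K \<in> components G"
  shows "is_vase_of_flowers K \<or> is_double_star K \<or> is_isolated_vertex K"
proof -
  let ?R = "joined (edges G)"
  obtain p where p: "p \<in> verts G" and K: "K = vertex_induced G {u \<in> verts G. connected_to G p u}"
    using K unfolding components_def by blast
  show ?thesis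
  proof (cases "\<exists>q. ?R p q")
    case False
    then have "{u \<in> verts G. connected_to G p u} = {p}"
      using p by (intro component_vertices) auto
    then have "K = Graph {p} {}"
      using edges_vertex_induced[of "{p}"] irrefl[of p] unfolding K by (auto simp: vertex_induced_def)
    then show ?thesis
      unfolding is_isolated_vertex_def by blast
  next
    case True
    then consider u v where "double_star_at ?R u v" "?R u p \<or> ?R v p"
      | x y z where "vase_at ?R x y z" "p = x \<or> ?R x p"
      using vase_or_double_star_at[OF no] by blast
    then show ?thesis
    proof cases
      case 1
      have R: "?R u v" "?R v u"
        using 1(1) sym unfolding double_star_at_def by blast+
      have "{w \<in> verts G. connected_to G p w} = {w. ?R u w \<or> ?R v w}"
      proof (rule component_vertices)
        show "w' \<in> {w. ?R u w \<or> ?R v w}" if "w \<in> {w. ?R u w \<or> ?R v w}" "?R w w'" for w w'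
          using that 1(1) R unfolding double_star_at_def by blast
        have "?R\<^sup>*\<^sup>* p u" "?R\<^sup>*\<^sup>* p v"
          using 1(2) R sym by (meson r_into_rtranclp rtranclp.rtrancl_into_rtrancl)+
        then show "?R\<^sup>*\<^sup>* p w" if "w \<in> {w. ?R u w \<or> ?R v w}" for w
          using that by (auto intro: rtranclp.rtrancl_into_rtrancl)
      qed (use 1(2) joined_verts in auto)
      then show ?thesis
        using double_star_at_is_double_star[OF 1(1)] unfolding K by simp
    next
      case 2
      have "{w \<in> verts G. connected_to G p w} = {w. w = x \<or> ?R x w}"
      proof (rule component_vertices)
        show "w' \<in> {w. w = x \<or> ?R x w}" if "w \<in> {w. w = x \<or> ?R x w}" "?R w w'" for w w'
          using that 2(1) unfolding vase_at_def by blast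
        have "?R\<^sup>*\<^sup>* p x"
          using 2(2) sym by blast
        then show "?R\<^sup>*\<^sup>* p w" if "w \<in> {w. w = x \<or> ?R x w}" for w
          using that by (auto intro: rtranclp.rtrancl_into_rtrancl)
      next
        show "{w. w = x \<or> ?R x w} \<subseteq> verts G"
          using joined_verts joined_verts[of x y] 2(1) unfolding vase_at_def by auto
      qed (use 2(2) in auto)
      then show ?thesis
        using vase_at_is_vase[OF 2(1)] unfolding K by simp
    qed
  qed
qed

text \<open>A forbidden walk lies in a single component, and an isomorphism would carry it to a
  standard vase or double star, where there is none.\<close>

lemma not_obstructed_iff_components:
  "\<not> obstructed (joined (edges G)) \<longleftrightarrow>
    (\<forall>K\<in>components G. is_vase_of_flowers K \<or> is_double_star K \<or> is_isolated_vertex K)"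
proof
  assume shape: "\<forall>K\<in>components G. is_vase_of_flowers K \<or> is_double_star K \<or> is_isolated_vertex K"
  show "\<not> obstructed (joined (edges G))"
  proof
    assume "obstructed (joined (edges G))"
    then obtain K where K: "K \<in> components G" "obstructed (joined (edges K))"
      using obstructed_component[OF G] by blast
    have "\<not> is_vase_of_flowers K"
    proof
      assume "is_vase_of_flowers K"
      then obtain n where "graph_iso (vase n) K"
        unfolding is_vase_of_flowers_def by blast
      moreover have "\<Union>(edges (vase n)) \<subseteq> verts (vase n)"
        unfolding vase_def by auto
      ultimately show False
        using obstructed_graph_iso[of "vase n" K] vase_not_obstructed[of n] K(2) by blast
    qed
    moreover have "\<not> is_double_star K"
    proof
      assume "is_double_star K"
      then obtain m n where "graph_iso (double_star m n) K"
        unfolding is_double_star_def by blast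
      moreover have "\<Union>(edges (double_star m n)) \<subseteq> verts (double_star m n)"
        unfolding double_star_def by auto
      ultimately show False
        using obstructed_graph_iso[of "double_star m n" K] double_star_not_obstructed[of m n] K(2) by blast
    qed
    moreover have "\<not> is_isolated_vertex K"
      using K(2) unfolding is_isolated_vertex_def obstructed_def joined_def by auto
    ultimately show False
      using shape K(1) by blast
  qed
qed (use component_shape in blast)

end

theorem theorem12:
  fixes G :: "'a graph"
  assumes "finite_simple_graph G"
  shows "(line_game_perfect Bob (Some Bob) G \<longleftrightarrow> line_game_perfect Alice (Some Bob) G)
    \<and> (line_game_perfect Alice (Some Bob) G \<longleftrightarrow> line_game_perfect Alice None G)
    \<and> (line_game_perfect Alice None G \<longleftrightarrow>
         \<not> has_edge_induced G (path_graph 5) \<and> \<not> has_edge_induced G (cycle_graph 4))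
    \<and> (\<not> has_edge_induced G (path_graph 5) \<and> \<not> has_edge_induced G (cycle_graph 4) \<longleftrightarrow>
         (\<forall>H\<in>components G. is_vase_of_flowers H \<or> is_double_star H \<or> is_isolated_vertex H))"
proof -
  have "line_game_perfect X Y G \<longleftrightarrow> \<not> obstructed (joined (edges G))"
    if "(X, Y) \<in> {(Bob, Some Bob), (Alice, Some Bob), (Alice, None)}" for X Y
    using that by (intro line_game_perfect_iff[OF assms]) auto
  then show ?thesis
    using obstructed_iff_has_edge_induced[OF assms] not_obstructed_iff_components[OF assms]
    by auto
qed

end
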